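(* Let $\gamma>0$, $a>0$, $p\geq 1$, $x_0\in\mathbb R$, $R>0$ and $0<\beta\leq 1$. Let $\Gamma:\mathbb R\times[0,1]\to\mathbb R$ be a function satisfying $$\Gamma(x,0)=x\quad\text{and}\quad |\Gamma(x,t)-\Gamma(x,t')|\leq C|t-t'|^\beta$$ for all $x\in B(x_0,R)$ and $t,t'\in[0,1]$, with a constant $C$ independent of $x,t,t'$. Suppose there exists $s_0\geq 0$ such that for each $s>s_0$ there is a constant $C_s$ with $$\Big\|\sup_{0<t<1}|P_{a,\gamma}^t(f)(\Gamma(x,t))|\Big\|_{L^p(B(x_0,R))}\leq C_s\|f\|_{H^s(\mathbb R)}\quad\text{for all } f\in H^s(\mathbb R).$$ Then: (1) If $a\geq\min\{1,\gamma\}$ and $\min\{1,\gamma\}/a\leq\beta\leq 1$, then for all $(\delta,h)\in D_1$, where $$D_1=\{(\delta,h):\ \delta\geq 0,\ h\geq 0,\ h\leq \delta\cdot\min\{1,\gamma\}/a,\ h<\min\{\beta,\gamma\}\},$$ and for each $s>s_0$ and $f\in H^{s+\delta}(\mathbb R)$, $$P_{a,\gamma}^t(f)(\Gamma(x,t))-f(x)=o(t^h)\quad\text{as } t\to0^+,\ \text{for a.e. } x\in B(x_0,R).$$ (2) If either $a\geq\min\{1,\gamma\}$ and $0<\beta<\min\{1,\gamma\}/a$, or $a<\min\{1,\gamma\}$ and $0<\beta\leq 1$, then for all $(\delta,h)\in D_2$, where $$D_2=\{(\delta,h):\ \delta\geq 0,\ h\geq 0,\ h\leq\beta\delta,\ h<\min\{\beta,\gamma\}\},$$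 and for each $s>s_0$ and $f\in H^{s+\delta}(\mathbb R)$, $$P_{a,\gamma}^t(f)(\Gamma(x,t))-f(x)=o(t^h)\quad\text{as } t\to0^+,\ \text{for a.e. } x\in B(x_0,R).$$
   Context: The Fourier transform is $\hat f(\xi)=\int_{\mathbb R}e^{-ix\xi}f(x)\,dx$. For $a>0$, $\gamma>0$, $t>0$ and $f\in L^2(\mathbb R)$, the Landau type Schrödinger operator is $$P_{a,\gamma}^t f(y)=P_{a,\gamma}^t(f)(y)=\frac{1}{2\pi}\int_{\mathbb R}\hat f(\xi)e^{iy\xi}e^{it|\xi|^a}e^{-t^\gamma|\xi|^a}\,d\xi .$$ $H^s(\mathbb R)$ is the $L^2$-based Sobolev space with norm $\|f\|_{H^s(\mathbb R)}=\big(\int_{\mathbb R}(1+|\xi|^2)^s|\hat f(\xi)|^2\,d\xi\big)^{1/2}$. $B(x_0,R)\subset\mathbb R$ is the ball (interval) with center $x_0$ and radius $R$. The $L^p(B(x_0,R))$ norm is taken in the variable $x$. *)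

theory Defs
  imports "HOL-Analysis.Analysis" "HOL-Library.Landau_Symbols"
begin

definition L2 :: "(real \<Rightarrow> complex) set" where
  "L2 = {f. f \<in> borel_measurable lebesgue \<and> integrable lebesgue (\<lambda>x. (cmod (f x))\<^sup>2)}"

text \<open>For a general \<open>f \<in> L2\<close> the integral \<open>\<integral> e\<^sup>-\<^sup>i\<^sup>x\<^sup>\<xi> f(x) dx\<close> does not converge absolutely;
  the Fourier transform is the limit in \<open>L\<^sup>2\<close> of its truncations to \<open>[-N, N]\<close>.  By Plancherel's
  theorem the limit exists, and it is unique up to a null set.\<close>

definition has_fourier_transform :: "(real \<Rightarrow> complex) \<Rightarrow> (real \<Rightarrow> complex) \<Rightarrow> bool" where
  "has_fourier_transform f g \<longleftrightarrow> g \<in> L2 \<and>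
     ((\<lambda>N::real. \<integral>\<^sup>+\<xi>. ennreal ((cmod
          ((LINT x:{-N..N}|lebesgue. exp (- (\<i> * of_real x * of_real \<xi>)) * f x) - g \<xi>))\<^sup>2)
        \<partial>lebesgue) \<longlongrightarrow> 0) at_top"

text \<open>A representative of the Fourier transform; it is only used under integrals, so the choice
  is immaterial.\<close>

definition fourier :: "(real \<Rightarrow> complex) \<Rightarrow> real \<Rightarrow> complex" where
  "fourier f = (SOME g. has_fourier_transform f g)"

definition landau_op :: "real \<Rightarrow> real \<Rightarrow> real \<Rightarrow> (real \<Rightarrow> complex) \<Rightarrow> real \<Rightarrow> complex" where
  "landau_op a \<gamma> t f y = 1 / (2 * of_real pi) *
     (LINT \<xi>|lebesgue. fourier f \<xi> * exp (\<i> * of_real y * of_real \<xi>)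
        * exp (\<i> * of_real (t * \<bar>\<xi>\<bar> powr a)) * of_real (exp (- (t powr \<gamma> * \<bar>\<xi>\<bar> powr a))))"

text \<open>For \<open>s \<ge> 0\<close>, the only range needed here, \<open>H\<^sup>s \<subseteq> L\<^sup>2\<close>.\<close>

definition sobolev :: "real \<Rightarrow> (real \<Rightarrow> complex) set" where
  "sobolev s = {f \<in> L2.
     integrable lebesgue (\<lambda>\<xi>. (1 + \<bar>\<xi>\<bar>\<^sup>2) powr s * (cmod (fourier f \<xi>))\<^sup>2)}"

definition sobolev_norm :: "real \<Rightarrow> (real \<Rightarrow> complex) \<Rightarrow> real" where
  "sobolev_norm s f =
     sqrt (LINT \<xi>|lebesgue. (1 + \<bar>\<xi>\<bar>\<^sup>2) powr s * (cmod (fourier f \<xi>))\<^sup>2)"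

text \<open>Real powers with a positive exponent on \<open>[0, \<infinity>]\<close>.\<close>

definition epowr :: "ennreal \<Rightarrow> real \<Rightarrow> ennreal" where
  "epowr u r = (if u = \<infinity> then \<infinity> else ennreal (enn2real u powr r))"

text \<open>\<open>\<Gamma>(\<cdot>, t)\<close> is not assumed measurable, so the maximal function need not be measurable, and
  on such functions \<^const>\<open>nn_integral\<close> is a lower integral, for which a maximal estimate has no
  content almost everywhere.  Hence the \<open>L\<^sup>p\<close> norm is built on the upper integral, which agrees with
  \<^const>\<open>nn_integral\<close> on measurable functions.\<close>

definition upper_nn_integral :: "'a measure \<Rightarrow> ('a \<Rightarrow> ennreal) \<Rightarrow> ennreal" where
  "upper_nn_integral M F =
     (INF G \<in> {G \<in> borel_measurable M. \<forall>x\<in>space M. F x \<le> G x}. \<integral>\<^sup>+x. G x \<partial>M)"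

lemma upper_nn_integral_eq_nn_integral:
  assumes "F \<in> borel_measurable M"
  shows "upper_nn_integral M F = (\<integral>\<^sup>+x. F x \<partial>M)"
  unfolding upper_nn_integral_def
  using assms by (intro antisym INF_lower2[of F] INF_greatest nn_integral_mono) auto

definition Lp_norm_on :: "real \<Rightarrow> real set \<Rightarrow> (real \<Rightarrow> ennreal) \<Rightarrow> ennreal" where
  "Lp_norm_on p A F = epowr (upper_nn_integral (lebesgue_on A) (\<lambda>x. epowr (F x) p)) (1 / p)"

definition maximal_fun ::
  "real \<Rightarrow> real \<Rightarrow> (real \<Rightarrow> real \<Rightarrow> real) \<Rightarrow> (real \<Rightarrow> complex) \<Rightarrow> real \<Rightarrow> ennreal" where
  "maximal_fun a \<gamma> \<Gamma> f x = (SUP t\<in>{0<..<1}. ennreal (cmod (landau_op a \<gamma> t f (\<Gamma> x t))))"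

definition D1 :: "real \<Rightarrow> real \<Rightarrow> real \<Rightarrow> (real \<times> real) set" where
  "D1 a \<gamma> \<beta> = {(\<delta>, h). \<delta> \<ge> 0 \<and> h \<ge> 0 \<and> h \<le> \<delta> * (min 1 \<gamma> / a) \<and> h < min \<beta> \<gamma>}"

definition D2 :: "real \<Rightarrow> real \<Rightarrow> (real \<times> real) set" where
  "D2 \<gamma> \<beta> = {(\<delta>, h). \<delta> \<ge> 0 \<and> h \<ge> 0 \<and> h \<le> \<beta> * \<delta> \<and> h < min \<beta> \<gamma>}"

end

theory Submission
  imports Defs "HOL-Probability.Characteristic_Functions" "HOL-Probability.Sinc_Integral"
begin

text \<open>
  The operator is the Fourier multiplier with symbol \<open>exp ((\<i> * t - t powr \<gamma>) * \<bar>\<xi>\<bar> powr a)\<close>, evaluated at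
  \<open>\<Gamma> x t\<close>.  Cut the Fourier transform of \<open>f\<close> into dyadic pieces \<open>P k\<close> with \<open>\<bar>\<xi>\<bar>\<close> comparable to
  \<open>2 ^ k\<close>.  Let \<open>\<kappa>\<close> be the larger of \<open>a / min 1 \<gamma>\<close> and \<open>1 / \<beta>\<close>: the two parts of the theorem are the two
  possibilities for the maximum, and both domains of \<open>(\<delta>, h)\<close> amount to
  \<open>\<kappa> * h \<le> \<delta>\<close> and \<open>h < \<mu>\<close>, where \<open>\<mu> = min \<beta> \<gamma>\<close>.

  At frequency \<open>L = 2 ^ k\<close> the critical time is \<open>L powr (-\<kappa>)\<close>.  Before it, the displacement
  \<open>\<Gamma> x t - x\<close>, the phase and the damping change the exponent of the multiplier by at most a constant times
  \<open>(t * L powr \<kappa>) powr \<mu>\<close>, and a Taylor expansion (\<open>taylor_majorant\<close>) bounds the difference to the initial datum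
  by this quantity times an integrable function independent of \<open>t\<close>.  After it, the assumed
  maximal estimate bounds the difference by an integrable function (\<open>Lp_majorant\<close>).
  Together these give \<open>band_limited_majorant\<close>: the difference for a single piece is at most
  \<open>min 1 ((t * L powr \<kappa>) powr \<mu>) * E x\<close>.  Divided by \<open>t powr h\<close> this costs
  \<open>L powr (\<kappa> * h) \<le> L powr \<delta>\<close>, which the additional \<open>\<delta>\<close> derivatives of \<open>f\<close> pay for.  Since the maximal
  estimate holds for some smoothness strictly below \<open>s\<close>, the bounds are summable over \<open>k\<close> at almost every
  \<open>x\<close>, and as each piece is \<open>o(t powr h)\<close>, so is the sum (\<open>convergence_rate\<close>).

  The argument compares pointwise values of \<open>f\<close>, of its transform and of the dyadic pieces, so it rests on the
  \<open>L\<^sup>2\<close> theory of the Fourier transform for the limit of truncated integrals: existence,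
  uniqueness and inversion.  This is developed first.  Gaussian regularisation gives the inequality half of
  Plancherel's identity (\<open>osc_L2_bound\<close>), hence existence by completeness, and the full identity
  against continuous test functions (\<open>plancherel_weak\<close>), hence inversion (\<open>osc_inversion\<close>).
\<close>

section \<open>Square-integrable functions\<close>

interpretation lebesgue: sigma_finite_measure "lebesgue :: real measure"
proof
  obtain A :: "real set set" where A: "countable A" "A \<subseteq> sets lborel" "\<Union>A = space lborel"
      "\<forall>a\<in>A. emeasure lborel a \<noteq> \<infinity>"
    using lborel.sigma_finite_countable by blast
  then show "\<exists>A::real set set. countable A \<and> A \<subseteq> sets lebesgue \<and> \<Union>A = space lebesgue \<and>
      (\<forall>a\<in>A. emeasure lebesgue a \<noteq> \<infinity>)"
    by (intro exI[of _ A]) (auto simp: subset_eq)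
qed

interpretation lebesgue_pair: pair_sigma_finite "lebesgue :: real measure" "lebesgue :: real measure" ..

definition l2sq :: "(real \<Rightarrow> complex) \<Rightarrow> ennreal" where
  "l2sq u = (\<integral>\<^sup>+x. ennreal ((cmod (u x))\<^sup>2) \<partial>lebesgue)"

text \<open>Truncation to \<open>[-N, N]\<close>.  The equation \<open>trunc L G = G\<close> is also the form in which the
  statement ``\<open>G\<close> vanishes outside \<open>[-L, L]\<close>'' is used below.\<close>
definition trunc :: "real \<Rightarrow> (real \<Rightarrow> complex) \<Rightarrow> real \<Rightarrow> complex" where
  "trunc N u x = (if \<bar>x\<bar> \<le> N then u x else 0)"

text \<open>With \<open>c = -1\<close> this is the Fourier integral, with \<open>c = 1\<close> it is \<open>2 * pi\<close>
  times the inverse one.  The sign is kept as a parameter, restricted to \<open>\<bar>c\<bar> = 1\<close>, because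
  every step of the \<open>L\<^sup>2\<close> theory is needed for both transforms.\<close>
definition osc :: "real \<Rightarrow> (real \<Rightarrow> complex) \<Rightarrow> real \<Rightarrow> complex" where
  "osc c u \<xi> = (LINT x|lebesgue. cis (c * x * \<xi>) * u x)"

lemma L2_iff: "u \<in> L2 \<longleftrightarrow> u \<in> borel_measurable lebesgue \<and> l2sq u < \<infinity>"
proof -
  have "integrable lebesgue (\<lambda>x. (cmod (u x))\<^sup>2) \<longleftrightarrow> l2sq u < \<infinity>" if [measurable]: "u \<in> borel_measurable lebesgue"
    unfolding l2sq_def integrable_iff_bounded by simp
  then show ?thesis unfolding L2_def by blast
qed

lemma L2_measurable [measurable_dest]: "u \<in> L2 \<Longrightarrow> u \<in> borel_measurable lebesgue"
  by (simp add: L2_iff)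

lemma l2sq_finite: "u \<in> L2 \<Longrightarrow> l2sq u < \<infinity>"
  by (simp add: L2_iff)

lemma l2sq_cong_AE: "AE x in lebesgue. u x = v x \<Longrightarrow> l2sq u = l2sq v"
  unfolding l2sq_def by (rule nn_integral_cong_AE) auto

lemma l2sq_mono: "(\<And>x. cmod (u x) \<le> cmod (v x)) \<Longrightarrow> l2sq u \<le> l2sq v"
  unfolding l2sq_def by (intro nn_integral_mono ennreal_leI power_mono) auto

lemma l2sq_add_le:
  assumes [measurable]: "u \<in> borel_measurable lebesgue" "v \<in> borel_measurable lebesgue"
  shows "l2sq (\<lambda>x. u x + v x) \<le> 2 * l2sq u + 2 * l2sq v"
proof -
  have "(cmod (u x + v x))\<^sup>2 \<le> 2 * (cmod (u x))\<^sup>2 + 2 * (cmod (v x))\<^sup>2" for x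
  proof -
    have "(cmod (u x + v x))\<^sup>2 \<le> (cmod (u x) + cmod (v x))\<^sup>2"
      by (intro power_mono norm_triangle_ineq) auto
    also have "\<dots> \<le> 2 * (cmod (u x))\<^sup>2 + 2 * (cmod (v x))\<^sup>2"
      using sum_squares_bound[of "cmod (u x)" "cmod (v x)"] by (simp add: power2_sum)
    finally show ?thesis .
  qed
  then have "l2sq (\<lambda>x. u x + v x) \<le> (\<integral>\<^sup>+x. 2 * ennreal ((cmod (u x))\<^sup>2) + 2 * ennreal ((cmod (v x))\<^sup>2) \<partial>lebesgue)"
    unfolding l2sq_def
    by (intro nn_integral_mono) (simp flip: ennreal_plus ennreal_mult'' ennreal_numeral)
  also have "\<dots> = 2 * l2sq u + 2 * l2sq v"
    unfolding l2sq_def by (simp add: nn_integral_add nn_integral_cmult)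
  finally show ?thesis .
qed

lemma l2sq_minus_commute: "l2sq (\<lambda>x. u x - v x) = l2sq (\<lambda>x. v x - u x)"
  unfolding l2sq_def by (simp add: norm_minus_commute)

lemma l2sq_triangle:
  assumes [measurable]: "u \<in> borel_measurable lebesgue" "v \<in> borel_measurable lebesgue" "w \<in> borel_measurable lebesgue"
  shows "l2sq (\<lambda>x. u x - w x) \<le> 2 * l2sq (\<lambda>x. u x - v x) + 2 * l2sq (\<lambda>x. v x - w x)"
  using l2sq_add_le[of "\<lambda>x. u x - v x" "\<lambda>x. v x - w x"] by simp

lemma l2sq_cmult: "l2sq (\<lambda>x. c * u x) = ennreal ((cmod c)\<^sup>2) * l2sq u"
  if [measurable]: "u \<in> borel_measurable lebesgue"
  unfolding l2sq_def by (simp add: norm_mult power_mult_distrib ennreal_mult nn_integral_cmult)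

lemma L2_add: "u \<in> L2 \<Longrightarrow> v \<in> L2 \<Longrightarrow> (\<lambda>x. u x + v x) \<in> L2"
  using l2sq_add_le[of u v]
  by (auto simp: L2_iff ennreal_mult_less_top top_unique less_top intro: le_less_trans)

lemma L2_cmult: "u \<in> L2 \<Longrightarrow> (\<lambda>x. c * u x) \<in> L2"
  by (auto simp: L2_iff l2sq_cmult ennreal_mult_less_top)

lemma L2_diff: "u \<in> L2 \<Longrightarrow> v \<in> L2 \<Longrightarrow> (\<lambda>x. u x - v x) \<in> L2"
  using L2_add[of u "\<lambda>x. (-1) * v x"] L2_cmult[of v "-1"] by simp

lemma L2_bounded_mult:
  assumes u: "u \<in> L2" and m [measurable]: "m \<in> borel_measurable lebesgue" and le: "\<And>x. cmod (m x) \<le> 1"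
  shows "(\<lambda>x. m x * u x) \<in> L2" "l2sq (\<lambda>x. m x * u x) \<le> l2sq u"
proof -
  show *: "l2sq (\<lambda>x. m x * u x) \<le> l2sq u"
    using le by (intro l2sq_mono) (simp add: norm_mult mult_left_le_one_le)
  with u show "(\<lambda>x. m x * u x) \<in> L2"
    unfolding L2_iff by (auto simp: le_less_trans)
qed

lemma trunc_eq_mult: "trunc N u = (\<lambda>x. indicator {-N..N} x * u x)"
  by (auto simp: trunc_def fun_eq_iff indicator_def abs_le_iff)

lemma trunc_measurable [measurable]:
  "u \<in> borel_measurable lebesgue \<Longrightarrow> trunc N u \<in> borel_measurable lebesgue"
  unfolding trunc_eq_mult by (intro borel_measurable_times borel_measurable_indicator) auto

lemma trunc_L2 [intro]: "u \<in> L2 \<Longrightarrow> trunc N u \<in> L2"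
  unfolding trunc_eq_mult
  by (rule L2_bounded_mult(1)) (simp_all add: borel_measurable_indicator split: split_indicator)

lemma trunc_trunc: "trunc M (trunc N u) = trunc (min M N) u"
  by (auto simp: trunc_def fun_eq_iff)

text \<open>Cauchy-Schwarz, for the bilinear pairing: complex conjugates would only have to be removed again
  when the pairing is combined with Fubini's theorem.\<close>
lemma L2_product:
  assumes u: "u \<in> L2" and v: "v \<in> L2"
  shows L2_mult_integrable: "integrable lebesgue (\<lambda>x. u x * v x)"
    and L2_Cauchy_Schwarz: "ennreal ((cmod (LINT x|lebesgue. u x * v x))\<^sup>2) \<le> l2sq u * l2sq v"
proof -
  note [measurable] = L2_measurable[OF u] L2_measurable[OF v]
  let ?I = "\<integral>\<^sup>+x. ennreal (cmod (u x)) * ennreal (cmod (v x)) \<partial>lebesgue"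
  have cs: "?I\<^sup>2 \<le> l2sq u * l2sq v"
    using Cauchy_Schwarz_nn_integral[of "\<lambda>x. ennreal (cmod (u x))" lebesgue "\<lambda>x. ennreal (cmod (v x))"]
    by (simp add: l2sq_def ennreal_power)
  have I: "?I = (\<integral>\<^sup>+x. ennreal (norm (u x * v x)) \<partial>lebesgue)"
    by (simp add: norm_mult ennreal_mult)
  have "?I\<^sup>2 < \<infinity>"
    using cs l2sq_finite[OF u] l2sq_finite[OF v] by (auto simp: ennreal_mult_less_top intro: le_less_trans)
  then have fin: "?I < \<infinity>"
    by (cases "?I = \<infinity>") (auto simp: power2_eq_square ennreal_mult_top less_top)
  then show int: "integrable lebesgue (\<lambda>x. u x * v x)"
    unfolding integrable_iff_bounded I by auto
  have "ennreal ((cmod (LINT x|lebesgue. u x * v x))\<^sup>2) = (ennreal (cmod (LINT x|lebesgue. u x * v x)))\<^sup>2"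
    by (simp add: ennreal_power)
  also have "\<dots> \<le> ?I\<^sup>2"
    unfolding I by (intro power_mono integral_norm_bound_ennreal int) auto
  finally show "ennreal ((cmod (LINT x|lebesgue. u x * v x))\<^sup>2) \<le> l2sq u * l2sq v"
    using cs by (rule order_trans)
qed

lemma indicator_L2: "(\<lambda>x. indicator {-N..N} x :: complex) \<in> L2"
proof -
  have "l2sq (\<lambda>x. indicator {-N..N} x :: complex) = (\<integral>\<^sup>+x. indicator {-N..N} x \<partial>lebesgue)"
    unfolding l2sq_def by (intro nn_integral_cong) (auto simp: indicator_def)
  also have "\<dots> < \<infinity>" by (simp add: emeasure_lborel_Icc_eq)
  finally show ?thesis by (simp add: L2_iff borel_measurable_indicator)
qed

lemma trunc_integrable: "u \<in> L2 \<Longrightarrow> integrable lebesgue (trunc N u)"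
  unfolding trunc_eq_mult using L2_mult_integrable[OF indicator_L2] .

lemma trunc_tendsto_L2:
  assumes u: "u \<in> L2"
  shows "((\<lambda>N. l2sq (\<lambda>x. trunc N u x - u x)) \<longlongrightarrow> 0) at_top"
proof (rule tendsto_at_topI_sequentially)
  fix X :: "nat \<Rightarrow> real" assume X: "filterlim X at_top sequentially"
  have [measurable]: "u \<in> borel_measurable lebesgue" using u by (rule L2_measurable)
  have "(\<lambda>n. \<integral>\<^sup>+x. ennreal ((cmod (trunc (X n) u x - u x))\<^sup>2) \<partial>lebesgue) \<longlonglongrightarrow> (\<integral>\<^sup>+x. 0 \<partial>(lebesgue::real measure))"
  proof (rule nn_integral_dominated_convergence[where w="\<lambda>x. ennreal ((cmod (u x))\<^sup>2)"])
    show "(\<integral>\<^sup>+x. ennreal ((cmod (u x))\<^sup>2) \<partial>lebesgue) < \<infinity>"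
      using l2sq_finite[OF u] by (simp add: l2sq_def)
    show "AE x in lebesgue. (\<lambda>n. ennreal ((cmod (trunc (X n) u x - u x))\<^sup>2)) \<longlonglongrightarrow> 0"
    proof (rule AE_I2)
      fix x
      have "eventually (\<lambda>n. ennreal ((cmod (trunc (X n) u x - u x))\<^sup>2) = 0) sequentially"
        using X[unfolded filterlim_at_top, rule_format, of "\<bar>x\<bar>"]
        by (rule eventually_mono) (simp add: trunc_def)
      then show "(\<lambda>n. ennreal ((cmod (trunc (X n) u x - u x))\<^sup>2)) \<longlonglongrightarrow> 0"
        by (rule tendsto_eventually)
    qed
    show "AE x in lebesgue. ennreal ((cmod (trunc (X n) u x - u x))\<^sup>2) \<le> ennreal ((cmod (u x))\<^sup>2)" for n
      by (simp add: trunc_def)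
  qed measurable
  then show "(\<lambda>n. l2sq (\<lambda>x. trunc (X n) u x - u x)) \<longlonglongrightarrow> 0"
    by (simp add: l2sq_def)
qed

text \<open>Strong convergence implies weak convergence: by Cauchy-Schwarz, the square of
  the error is at most \<open>l2sq w\<close> times the squared distance of \<open>U N\<close> to \<open>g\<close>.\<close>
lemma L2_tendsto_integral:
  assumes U: "\<And>N. U N \<in> L2" and g: "g \<in> L2" and w: "w \<in> L2"
    and lim: "((\<lambda>N. l2sq (\<lambda>x. U N x - g x)) \<longlongrightarrow> 0) F"
  shows "((\<lambda>N. LINT x|lebesgue. U N x * w x) \<longlongrightarrow> (LINT x|lebesgue. g x * w x)) F"
proof -
  have "((\<lambda>N. l2sq (\<lambda>x. U N x - g x) * l2sq w) \<longlongrightarrow> 0 * l2sq w) F"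
    using l2sq_finite[OF w] lim by (intro tendsto_mult_ennreal tendsto_const) auto
  then have lim': "((\<lambda>N. l2sq (\<lambda>x. U N x - g x) * l2sq w) \<longlongrightarrow> 0) F" by simp
  have "((\<lambda>N. ennreal ((cmod (LINT x|lebesgue. (U N x - g x) * w x))\<^sup>2)) \<longlongrightarrow> 0) F"
  proof (rule tendsto_sandwich[where f="\<lambda>_. 0" and h="\<lambda>N. l2sq (\<lambda>x. U N x - g x) * l2sq w", rotated 2])
    show "((\<lambda>_. 0 :: ennreal) \<longlongrightarrow> 0) F" by (rule tendsto_const)
    show "((\<lambda>N. l2sq (\<lambda>x. U N x - g x) * l2sq w) \<longlongrightarrow> 0) F" by (rule lim')
    show "eventually (\<lambda>N. 0 \<le> ennreal ((cmod (LINT x|lebesgue. (U N x - g x) * w x))\<^sup>2)) F"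
      by simp
    show "eventually (\<lambda>N. ennreal ((cmod (LINT x|lebesgue. (U N x - g x) * w x))\<^sup>2) \<le> l2sq (\<lambda>x. U N x - g x) * l2sq w) F"
      by (intro always_eventually allI L2_Cauchy_Schwarz L2_diff U g w)
  qed
  then have "((\<lambda>N. (cmod (LINT x|lebesgue. (U N x - g x) * w x))\<^sup>2) \<longlongrightarrow> 0) F"
    by (subst (asm) ennreal_0[symmetric], subst (asm) tendsto_ennreal_iff) auto
  then have "((\<lambda>N. sqrt ((cmod (LINT x|lebesgue. (U N x - g x) * w x))\<^sup>2)) \<longlongrightarrow> sqrt 0) F"
    by (rule tendsto_real_sqrt)
  then have "((\<lambda>N. LINT x|lebesgue. (U N x - g x) * w x) \<longlongrightarrow> 0) F"
    by (simp add: tendsto_norm_zero_iff)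
  moreover have "(LINT x|lebesgue. (U N x - g x) * w x) = (LINT x|lebesgue. U N x * w x) - (LINT x|lebesgue. g x * w x)" for N
    using L2_mult_integrable[OF U[of N] w] L2_mult_integrable[OF g w]
    by (simp add: left_diff_distrib)
  ultimately show ?thesis
    by (simp add: LIM_zero_iff)
qed

section \<open>Fourier integrals and Plancherel's identity\<close>

lemma lebesgue_id_measurable [measurable]: "(\<lambda>x::real. x) \<in> borel_measurable lebesgue"
  by (simp add: measurable_completion)

lemma cis_borel_measurable [measurable]: "cis \<in> borel_measurable borel"
  by (intro borel_measurable_continuous_onI continuous_intros)

lemma cnj_borel_measurable [measurable]: "cnj \<in> borel_measurable borel"
  by (intro borel_measurable_continuous_onI continuous_intros)

lemma osc_measurable [measurable]:
  assumes [measurable]: "u \<in> borel_measurable lebesgue"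
  shows "osc c u \<in> borel_measurable lebesgue"
  unfolding osc_def by measurable

lemma osc_integrand_integrable:
  assumes u: "integrable lebesgue u"
  shows "integrable lebesgue (\<lambda>x. cis (c * x * \<xi>) * u x)"
  using borel_measurable_integrable[OF u]
  by (intro Bochner_Integration.integrable_bound[OF integrable_norm[OF u]]) (auto simp: norm_mult)

lemma norm_osc_le: "cmod (osc c u \<xi>) \<le> (LINT x|lebesgue. cmod (u x))"
proof (cases "integrable lebesgue (\<lambda>x. cis (c * x * \<xi>) * u x)")
  case True
  have "cmod (osc c u \<xi>) \<le> (LINT x|lebesgue. cmod (cis (c * x * \<xi>) * u x))"
    unfolding osc_def by (rule integral_norm_bound)
  then show ?thesis by (simp add: norm_mult)
qed (simp add: osc_def not_integrable_integral_eq)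

lemma osc_cnj: "cnj (osc c u \<xi>) = osc (-c) (\<lambda>x. cnj (u x)) \<xi>"
  unfolding osc_def by (simp flip: Bochner_Integration.integral_cnj add: cis_cnj)

lemma osc_diff:
  assumes "integrable lebesgue u" "integrable lebesgue v"
  shows "osc c (\<lambda>x. u x - v x) \<xi> = osc c u \<xi> - osc c v \<xi>"
  using osc_integrand_integrable[OF assms(1)] osc_integrand_integrable[OF assms(2)]
  unfolding osc_def by (simp add: right_diff_distrib)

lemma osc_mult_bounded_integrable:
  assumes u: "integrable lebesgue u" and w: "integrable lebesgue w"
  shows "integrable lebesgue (\<lambda>\<xi>. osc c u \<xi> * w \<xi>)"
proof (rule Bochner_Integration.integrable_bound)
  note [measurable] = borel_measurable_integrable[OF u] borel_measurable_integrable[OF w]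
  show "integrable lebesgue (\<lambda>\<xi>. (LINT x|lebesgue. cmod (u x)) * cmod (w \<xi>))"
    using w by (intro integrable_mult_right integrable_norm)
  show "(\<lambda>\<xi>. osc c u \<xi> * w \<xi>) \<in> borel_measurable lebesgue" by measurable
  show "AE \<xi> in lebesgue. norm (osc c u \<xi> * w \<xi>) \<le> norm ((LINT x|lebesgue. cmod (u x)) * cmod (w \<xi>))"
    using norm_osc_le[of c u] by (auto simp: norm_mult intro!: mult_right_mono intro: order_trans[OF _ abs_ge_self])
qed

text \<open>Fubini's theorem for the kernel \<open>cis (c * x * \<xi>)\<close>, which is symmetric in its two variables: the
  transform can be moved from one factor to the other.\<close>
lemma osc_multiplication_formula:
  assumes u: "integrable lebesgue u" and w: "integrable lebesgue w"
  shows "(LINT \<xi>|lebesgue. osc c u \<xi> * w \<xi>) = (LINT x|lebesgue. u x * osc c w x)"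
proof -
  note [measurable] = borel_measurable_integrable[OF u] borel_measurable_integrable[OF w]
  define k where "k = (\<lambda>x \<xi>. cis (c * x * \<xi>) * u x * w \<xi>)"
  have meas: "case_prod k \<in> borel_measurable (lebesgue \<Otimes>\<^sub>M lebesgue)"
    unfolding k_def by measurable
  have int: "integrable (lebesgue \<Otimes>\<^sub>M lebesgue) (case_prod k)"
  proof (rule lebesgue_pair.Fubini_integrable[OF meas])
    have "integrable lebesgue (\<lambda>x. cmod (u x) * (LINT \<xi>|lebesgue. cmod (w \<xi>)))"
      using u by (intro integrable_mult_left integrable_norm)
    then show "integrable lebesgue (\<lambda>x. LINT \<xi>|lebesgue. norm (case_prod k (x, \<xi>)))"
      by (simp add: k_def norm_mult)
    have "integrable lebesgue (k x)" for x
      unfolding k_def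
      by (rule Bochner_Integration.integrable_bound[of _ "\<lambda>\<xi>. cmod (u x) * cmod (w \<xi>)"])
         (auto simp: norm_mult intro!: integrable_mult_right integrable_norm w)
    then show "AE x in lebesgue. integrable lebesgue (\<lambda>\<xi>. case_prod k (x, \<xi>))"
      by simp
  qed
  have "(LINT \<xi>|lebesgue. osc c u \<xi> * w \<xi>) = (LINT \<xi>|lebesgue. LINT x|lebesgue. k x \<xi>)"
    unfolding osc_def k_def
    by (intro Bochner_Integration.integral_cong refl) (simp flip: integral_mult_left_zero)
  also have "\<dots> = (LINT x|lebesgue. LINT \<xi>|lebesgue. k x \<xi>)"
    using lebesgue_pair.Fubini_integral[OF int] .
  also have "\<dots> = (LINT x|lebesgue. u x * osc c w x)"
    unfolding osc_def k_def
    by (intro Bochner_Integration.integral_cong refl) (simp flip: integral_mult_right_zero add: mult_ac)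
  finally show ?thesis .
qed

lemma normal_density_commute: "normal_density x \<sigma> y = normal_density y \<sigma> x"
  by (simp add: normal_density_def power2_commute)

lemma normal_density_integrable_lebesgue:
  "\<sigma> > 0 \<Longrightarrow> integrable lebesgue (normal_density \<mu> \<sigma>)"
  using integrable_normal_density[of \<sigma> \<mu>] by (simp add: integrable_completion)

lemma normal_density_nn_integral_lebesgue:
  assumes "\<sigma> > 0"
  shows "(\<integral>\<^sup>+y. ennreal (normal_density x \<sigma> y) \<partial>lebesgue) = 1"
  using assms integral_normal_density[of \<sigma> x] integrable_normal_density[of \<sigma> x]
  by (simp add: nn_integral_completion nn_integral_eq_integral)

text \<open>The summability kernel.  A Gaussian factor makes every integral below absolutely
  convergent, and its own transform is \<open>2 * pi\<close> times a normal density.\<close>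
definition gauss :: "real \<Rightarrow> real \<Rightarrow> complex" where
  "gauss \<sigma> \<xi> = of_real (exp (- (\<sigma> * \<xi>)\<^sup>2 / 2))"

lemma gauss_eq_density:
  assumes "\<sigma> > 0"
  shows "gauss \<sigma> \<xi> = of_real (sqrt (2 * pi) / \<sigma> * normal_density 0 (1 / \<sigma>) \<xi>)"
proof -
  have "sqrt (2 * pi * (1 / \<sigma>)\<^sup>2) = sqrt (2 * pi) / \<sigma>"
    using assms by (simp add: real_sqrt_mult real_sqrt_divide power_divide)
  moreover have "- (\<sigma> * \<xi>)\<^sup>2 / 2 = - (\<xi> - 0)\<^sup>2 / (2 * (1 / \<sigma>)\<^sup>2)"
    using assms by (simp add: field_simps)
  ultimately show ?thesis
    using assms by (simp add: gauss_def normal_density_def)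
qed

lemma gauss_integrable:
  assumes "\<sigma> > 0"
  shows "integrable lebesgue (gauss \<sigma>)"
proof -
  have "gauss \<sigma> = (\<lambda>\<xi>. of_real (sqrt (2 * pi) / \<sigma> * normal_density 0 (1 / \<sigma>) \<xi>))"
    using gauss_eq_density[OF assms] by (rule ext)
  then show ?thesis
    using assms by (simp only:)
      (intro integrable_of_real integrable_mult_right normal_density_integrable_lebesgue, simp)
qed

lemma gauss_measurable [measurable]: "gauss \<sigma> \<in> borel_measurable lebesgue"
  unfolding gauss_def by measurable

text \<open>The characteristic function of the standard normal distribution, after rescaling.\<close>
lemma gauss_fourier:
  assumes \<sigma>: "\<sigma> > 0"
  shows "(LINT \<xi>|lebesgue. cis (z * \<xi>) * gauss \<sigma> \<xi>) = of_real (2 * pi * normal_density 0 \<sigma> z)"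
proof -
  have [measurable]: "(\<lambda>\<xi>. cis (z * \<xi>) * gauss \<sigma> \<xi>) \<in> borel_measurable borel"
    unfolding gauss_def by measurable
  have "(LINT \<xi>|lebesgue. cis (z * \<xi>) * gauss \<sigma> \<xi>) = (LINT \<xi>|lborel. cis (z * \<xi>) * gauss \<sigma> \<xi>)"
    by (simp add: integral_completion)
  also have "\<dots> = \<bar>1 / \<sigma>\<bar> *\<^sub>R (LINT \<eta>|lborel. cis (z * (0 + 1 / \<sigma> * \<eta>)) * gauss \<sigma> (0 + 1 / \<sigma> * \<eta>))"
    using \<sigma> by (intro lborel_integral_real_affine) auto
  also have "(\<lambda>\<eta>. cis (z * (0 + 1 / \<sigma> * \<eta>)) * gauss \<sigma> (0 + 1 / \<sigma> * \<eta>)) =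
      (\<lambda>\<eta>. of_real (sqrt (2 * pi)) * (std_normal_density \<eta> *\<^sub>R iexp (z / \<sigma> * \<eta>)))"
    using \<sigma> by (auto simp: fun_eq_iff gauss_def std_normal_density_def cis_conv_exp scaleR_conv_of_real)
  also have "(LINT \<eta>|lborel. of_real (sqrt (2 * pi)) * (std_normal_density \<eta> *\<^sub>R iexp (z / \<sigma> * \<eta>))) =
      of_real (sqrt (2 * pi)) * char std_normal_distribution (z / \<sigma>)"
    unfolding char_def by (subst integral_mult_right_zero) (simp add: integral_density)
  also have "\<bar>1 / \<sigma>\<bar> *\<^sub>R (of_real (sqrt (2 * pi)) * char std_normal_distribution (z / \<sigma>)) =
      of_real (sqrt (2 * pi) / \<sigma> * exp (- ((z / \<sigma>)\<^sup>2) / 2))"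
    using \<sigma> by (simp add: char_std_normal_distribution scaleR_conv_of_real)
  also have "sqrt (2 * pi) / \<sigma> * exp (- ((z / \<sigma>)\<^sup>2) / 2) = 2 * pi * normal_density 0 \<sigma> z"
  proof -
    define r where "r = sqrt (2 * pi)"
    have r: "2 * pi = r * r" "r > 0" by (simp_all add: r_def)
    have "sqrt (2 * pi * \<sigma>\<^sup>2) = r * \<sigma>"
      using \<sigma> by (simp add: real_sqrt_mult r_def)
    then have "2 * pi / sqrt (2 * pi * \<sigma>\<^sup>2) = sqrt (2 * pi) / \<sigma>"
      using \<sigma> r by (simp add: r_def[symmetric])
    moreover have "(z / \<sigma>)\<^sup>2 / 2 = (z - 0)\<^sup>2 / (2 * \<sigma>\<^sup>2)"
      using \<sigma> by (simp add: field_simps)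
    ultimately have "2 * pi / sqrt (2 * pi * \<sigma>\<^sup>2) * exp (- ((z - 0)\<^sup>2 / (2 * \<sigma>\<^sup>2))) =
        sqrt (2 * pi) / \<sigma> * exp (- ((z / \<sigma>)\<^sup>2 / 2))"
      by simp
    then show ?thesis
      by (simp add: normal_density_def)
  qed
  finally show ?thesis .
qed

text \<open>Regularised Parseval identity.  Moving both transforms onto the Gaussian turns it into \<open>2 * pi\<close>
  times the normal density of width \<open>\<sigma>\<close>, so the right-hand side is the pairing of \<open>u\<close> with a smoothing of
  \<open>w\<close> that tends to \<open>w\<close> as \<open>\<sigma>\<close> tends to zero.\<close>
lemma osc_gauss_pairing:
  fixes u w :: "real \<Rightarrow> complex"
  assumes u: "integrable lebesgue u" and w: "integrable lebesgue w"
    and \<sigma>: "\<sigma> > 0" and c: "\<bar>c\<bar> = 1"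
  shows "(LINT \<xi>|lebesgue. osc c u \<xi> * (osc (-c) w \<xi> * gauss \<sigma> \<xi>)) =
    2 * pi * (LINT x|lebesgue. u x * (LINT y|lebesgue. w y * of_real (normal_density x \<sigma> y)))"
proof -
  have inner: "osc c (\<lambda>\<xi>. osc (-c) w \<xi> * gauss \<sigma> \<xi>) x =
      2 * pi * (LINT y|lebesgue. w y * of_real (normal_density x \<sigma> y))" for x
  proof -
    have "osc c (\<lambda>\<xi>. osc (-c) w \<xi> * gauss \<sigma> \<xi>) x =
        (LINT \<xi>|lebesgue. osc (-c) w \<xi> * (cis (c * \<xi> * x) * gauss \<sigma> \<xi>))"
      by (simp add: osc_def mult_ac)
    also have "\<dots> = (LINT y|lebesgue. w y * osc (-c) (\<lambda>\<xi>. cis (c * \<xi> * x) * gauss \<sigma> \<xi>) y)"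
      by (intro osc_multiplication_formula w osc_integrand_integrable gauss_integrable \<sigma>)
    also have "(\<lambda>y. osc (-c) (\<lambda>\<xi>. cis (c * \<xi> * x) * gauss \<sigma> \<xi>) y) = (\<lambda>y. of_real (2 * pi * normal_density x \<sigma> y))"
    proof (rule ext)
      fix y
      have "osc (-c) (\<lambda>\<xi>. cis (c * \<xi> * x) * gauss \<sigma> \<xi>) y = (LINT \<xi>|lebesgue. cis (c * (x - y) * \<xi>) * gauss \<sigma> \<xi>)"
      proof -
        have "cis (-c * \<xi> * y) * cis (c * \<xi> * x) = cis (c * (x - y) * \<xi>)" for \<xi>
          unfolding cis_mult by (rule arg_cong[of _ _ cis]) (simp add: algebra_simps)
        then show ?thesis unfolding osc_def mult.assoc[symmetric] by simp
      qed
      also have "\<dots> = of_real (2 * pi * normal_density 0 \<sigma> (c * (x - y)))"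
        using \<sigma> by (rule gauss_fourier)
      also have "normal_density 0 \<sigma> (c * (x - y)) = normal_density x \<sigma> y"
        using c power2_abs[of c] by (simp add: normal_density_def power_mult_distrib power2_commute)
      finally show "osc (-c) (\<lambda>\<xi>. cis (c * \<xi> * x) * gauss \<sigma> \<xi>) y = of_real (2 * pi * normal_density x \<sigma> y)" .
    qed
    also have "(LINT y|lebesgue. w y * of_real (2 * pi * normal_density x \<sigma> y)) =
        (LINT y|lebesgue. (2 * pi) * (w y * of_real (normal_density x \<sigma> y)))"
      by (intro Bochner_Integration.integral_cong) (auto simp: mult_ac)
    also have "\<dots> = 2 * pi * (LINT y|lebesgue. w y * of_real (normal_density x \<sigma> y))"
      by (rule integral_mult_right_zero)
    finally show ?thesis .
  qed
  have "(LINT \<xi>|lebesgue. osc c u \<xi> * (osc (-c) w \<xi> * gauss \<sigma> \<xi>)) =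
      (LINT x|lebesgue. u x * osc c (\<lambda>\<xi>. osc (-c) w \<xi> * gauss \<sigma> \<xi>) x)"
    by (intro osc_multiplication_formula u osc_mult_bounded_integrable w gauss_integrable \<sigma>)
  also have "\<dots> = (LINT x|lebesgue. (2 * pi) * (u x * (LINT y|lebesgue. w y * of_real (normal_density x \<sigma> y))))"
    unfolding inner by (simp add: mult_ac)
  also have "\<dots> = 2 * pi * (LINT x|lebesgue. u x * (LINT y|lebesgue. w y * of_real (normal_density x \<sigma> y)))"
    by (rule integral_mult_right_zero)
  finally show ?thesis .
qed

text \<open>The upper half of Plancherel's identity.  Take \<open>w = cnj u\<close> in the regularised identity: as
  \<open>2 * \<bar>u x\<bar> * \<bar>u y\<bar> \<le> \<bar>u x\<bar>\<^sup>2 + \<bar>u y\<bar>\<^sup>2\<close> and the normal density has mass one in each variable, the right-hand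
  side is at most \<open>2 * pi * l2sq u\<close> for every \<open>\<sigma>\<close>.  Fatou's lemma removes the Gaussian.\<close>
lemma osc_L2_bound:
  assumes u: "u \<in> L2" "integrable lebesgue u" and c: "\<bar>c\<bar> = 1"
  shows "l2sq (osc c u) \<le> ennreal (2 * pi) * l2sq u"
proof -
  note [measurable] = L2_measurable[OF u(1)]
  have cu: "integrable lebesgue (\<lambda>x. cnj (u x))" using u(2) by simp
  define I where "I \<sigma> = (\<integral>\<^sup>+\<xi>. ennreal ((cmod (osc c u \<xi>))\<^sup>2 * exp (- (\<sigma> * \<xi>)\<^sup>2 / 2)) \<partial>lebesgue)" for \<sigma>
  have bound: "I \<sigma> \<le> ennreal (2 * pi) * l2sq u" if \<sigma>: "\<sigma> > 0" for \<sigma>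
  proof -
    let ?n = "\<lambda>x y. normal_density x \<sigma> y"
    have "integrable lebesgue (\<lambda>\<xi>. osc c u \<xi> * (osc (-c) (\<lambda>x. cnj (u x)) \<xi> * gauss \<sigma> \<xi>))"
      by (intro osc_mult_bounded_integrable u cu gauss_integrable \<sigma>)
    also have "(\<lambda>\<xi>. osc c u \<xi> * (osc (-c) (\<lambda>x. cnj (u x)) \<xi> * gauss \<sigma> \<xi>)) =
        (\<lambda>\<xi>. of_real ((cmod (osc c u \<xi>))\<^sup>2 * exp (- (\<sigma> * \<xi>)\<^sup>2 / 2)))" (is "?l = ?r")
      by (simp add: fun_eq_iff gauss_def flip: osc_cnj mult.assoc complex_norm_square)
    finally have intr: "integrable lebesgue ?r" .
    have r: "integrable lebesgue (\<lambda>\<xi>. (cmod (osc c u \<xi>))\<^sup>2 * exp (- (\<sigma> * \<xi>)\<^sup>2 / 2))"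
      using Bochner_Integration.integrable_Re[OF intr] unfolding Re_complex_of_real .
    have "I \<sigma> = ennreal (LINT \<xi>|lebesgue. (cmod (osc c u \<xi>))\<^sup>2 * exp (- (\<sigma> * \<xi>)\<^sup>2 / 2))"
      unfolding I_def by (rule nn_integral_eq_integral[OF r]) simp
    also have "\<dots> \<le> ennreal (cmod (of_real (LINT \<xi>|lebesgue. (cmod (osc c u \<xi>))\<^sup>2 * exp (- (\<sigma> * \<xi>)\<^sup>2 / 2))))"
      by (simp only: norm_of_real ennreal_leI abs_ge_self)
    also have "of_real (LINT \<xi>|lebesgue. (cmod (osc c u \<xi>))\<^sup>2 * exp (- (\<sigma> * \<xi>)\<^sup>2 / 2)) = (LINT \<xi>|lebesgue. ?r \<xi>)"
      by (rule integral_of_real[OF r, symmetric])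
    also have "(LINT \<xi>|lebesgue. ?r \<xi>) =
        2 * pi * (LINT x|lebesgue. u x * (LINT y|lebesgue. cnj (u y) * of_real (?n x y)))"
      unfolding \<open>?l = ?r\<close>[symmetric] using u(2) cu \<sigma> c by (rule osc_gauss_pairing)
    also have "ennreal (cmod \<dots>) \<le>
        ennreal (2 * pi) * (\<integral>\<^sup>+x. \<integral>\<^sup>+y. ennreal (cmod (u x) * cmod (u y) * ?n x y) \<partial>lebesgue \<partial>lebesgue)"
    proof -
      have nn: "ennreal (norm (LINT x|M. f x)) \<le> (\<integral>\<^sup>+x. ennreal (norm (f x)) \<partial>M)" for M and f :: "real \<Rightarrow> complex"
        by (cases "integrable M f") (simp_all add: integral_norm_bound_ennreal not_integrable_integral_eq)
      have "ennreal (cmod (LINT x|lebesgue. u x * (LINT y|lebesgue. cnj (u y) * of_real (?n x y)))) \<le>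
          (\<integral>\<^sup>+x. ennreal (norm (u x * (LINT y|lebesgue. cnj (u y) * of_real (?n x y)))) \<partial>lebesgue)"
        by (rule nn)
      also have "\<dots> \<le> (\<integral>\<^sup>+x. \<integral>\<^sup>+y. ennreal (cmod (u x) * cmod (u y) * ?n x y) \<partial>lebesgue \<partial>lebesgue)"
      proof (rule nn_integral_mono)
        fix x
        have "ennreal (norm (u x * (LINT y|lebesgue. cnj (u y) * of_real (?n x y)))) =
            ennreal (norm (LINT y|lebesgue. u x * (cnj (u y) * of_real (?n x y))))"
          by simp
        also have "\<dots> \<le> (\<integral>\<^sup>+y. ennreal (norm (u x * (cnj (u y) * of_real (?n x y)))) \<partial>lebesgue)"
          by (rule nn)
        finally show "ennreal (norm (u x * (LINT y|lebesgue. cnj (u y) * of_real (?n x y)))) \<le>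
            (\<integral>\<^sup>+y. ennreal (cmod (u x) * cmod (u y) * ?n x y) \<partial>lebesgue)"
          by (simp add: norm_mult mult.assoc)
      qed
      finally show ?thesis
        by (simp add: norm_mult ennreal_mult mult_left_mono)
    qed
    also have "\<dots> \<le> ennreal (2 * pi) * l2sq u"
    proof (rule mult_left_mono)
      let ?J = "\<integral>\<^sup>+x. \<integral>\<^sup>+y. ennreal (cmod (u x) * cmod (u y) * ?n x y) \<partial>lebesgue \<partial>lebesgue"
      have A: "(\<integral>\<^sup>+x. \<integral>\<^sup>+y. ennreal ((cmod (u x))\<^sup>2) * ennreal (?n x y) \<partial>lebesgue \<partial>lebesgue) = l2sq u"
        unfolding l2sq_def by (simp add: nn_integral_cmult normal_density_nn_integral_lebesgue[OF \<sigma>])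
      have meas: "(\<lambda>(x, y). ennreal ((cmod (u y))\<^sup>2) * ennreal (?n x y)) \<in> borel_measurable (lebesgue \<Otimes>\<^sub>M lebesgue)"
        unfolding normal_density_def by measurable
      have B: "(\<integral>\<^sup>+x. \<integral>\<^sup>+y. ennreal ((cmod (u y))\<^sup>2) * ennreal (?n x y) \<partial>lebesgue \<partial>lebesgue) = l2sq u"
        using lebesgue_pair.Fubini'[OF meas] A by (simp add: normal_density_commute)
      have "2 * ?J = (\<integral>\<^sup>+x. \<integral>\<^sup>+y. 2 * ennreal (cmod (u x) * cmod (u y) * ?n x y) \<partial>lebesgue \<partial>lebesgue)"
        unfolding normal_density_def by (simp add: nn_integral_cmult)
      also have "\<dots> \<le> (\<integral>\<^sup>+x. \<integral>\<^sup>+y. ennreal ((cmod (u x))\<^sup>2) * ennreal (?n x y) + ennreal ((cmod (u y))\<^sup>2) * ennreal (?n x y) \<partial>lebesgue \<partial>lebesgue)"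
      proof (intro nn_integral_mono)
        fix x y
        have "2 * (cmod (u x) * cmod (u y) * ?n x y) \<le> (cmod (u x))\<^sup>2 * ?n x y + (cmod (u y))\<^sup>2 * ?n x y"
          using mult_right_mono[OF sum_squares_bound[of "cmod (u x)" "cmod (u y)"], of "?n x y"]
          by (simp add: algebra_simps)
        then show "2 * ennreal (cmod (u x) * cmod (u y) * ?n x y) \<le> ennreal ((cmod (u x))\<^sup>2) * ennreal (?n x y) + ennreal ((cmod (u y))\<^sup>2) * ennreal (?n x y)"
          by (simp flip: ennreal_plus ennreal_mult ennreal_mult'' ennreal_numeral)
      qed
      also have "\<dots> = (\<integral>\<^sup>+x. \<integral>\<^sup>+y. ennreal ((cmod (u x))\<^sup>2) * ennreal (?n x y) \<partial>lebesgue \<partial>lebesgue) +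
          (\<integral>\<^sup>+x. \<integral>\<^sup>+y. ennreal ((cmod (u y))\<^sup>2) * ennreal (?n x y) \<partial>lebesgue \<partial>lebesgue)"
        unfolding normal_density_def by (simp add: nn_integral_add)
      also have "\<dots> = l2sq u + l2sq u"
        by (simp only: A B)
      finally show "?J \<le> l2sq u"
        by (simp add: mult_2[symmetric] ennreal_mult_le_mult_iff)
    qed simp
    finally show ?thesis .
  qed
  have lim: "(\<lambda>n. ennreal ((cmod (osc c u \<xi>))\<^sup>2 * exp (- (inverse (real (Suc n)) * \<xi>)\<^sup>2 / 2))) \<longlonglongrightarrow>
      ennreal ((cmod (osc c u \<xi>))\<^sup>2)" for \<xi>
  proof -
    have "(\<lambda>n. (cmod (osc c u \<xi>))\<^sup>2 * exp (- (inverse (real (Suc n)) * \<xi>)\<^sup>2 / 2)) \<longlonglongrightarrow>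
        (cmod (osc c u \<xi>))\<^sup>2 * exp (- (0 * \<xi>)\<^sup>2 / 2)"
      by (intro tendsto_intros LIMSEQ_inverse_real_of_nat) auto
    then show ?thesis by (intro tendsto_ennrealI) simp
  qed
  have "l2sq (osc c u) = (\<integral>\<^sup>+\<xi>. liminf (\<lambda>n. ennreal ((cmod (osc c u \<xi>))\<^sup>2 * exp (- (inverse (real (Suc n)) * \<xi>)\<^sup>2 / 2))) \<partial>lebesgue)"
    unfolding l2sq_def by (intro nn_integral_cong) (simp only: lim_imp_Liminf[OF trivial_limit_sequentially lim])
  also have "\<dots> \<le> liminf (\<lambda>n. I (inverse (real (Suc n))))"
    unfolding I_def by (rule nn_integral_liminf) measurable
  also have "\<dots> \<le> ennreal (2 * pi) * l2sq u"
    by (intro Liminf_le always_eventually allI bound) auto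
  finally show ?thesis .
qed

lemma osc_L2:
  assumes "u \<in> L2" "integrable lebesgue u" "\<bar>c\<bar> = 1"
  shows "osc c u \<in> L2"
  using osc_L2_bound[OF assms] assms(1)
  unfolding L2_iff by (auto simp: ennreal_mult_less_top intro: le_less_trans)

text \<open>After the substitution \<open>y = x + \<sigma> * z\<close> the width appears only in the argument of \<open>v\<close>, and
  continuity and boundedness of \<open>v\<close> give dominated convergence.\<close>
lemma gauss_smoothing_tendsto:
  fixes v :: "real \<Rightarrow> complex"
  assumes cont: "continuous_on UNIV v" and bdd: "\<And>x. cmod (v x) \<le> B"
  shows "(\<lambda>n. LINT y|lebesgue. v y * of_real (normal_density x (inverse (real (Suc n))) y)) \<longlonglongrightarrow> v x"
proof -
  have [measurable]: "v \<in> borel_measurable borel"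
    using cont by (rule borel_measurable_continuous_onI)
  have eq: "(LINT y|lebesgue. v y * of_real (normal_density x \<sigma> y)) =
      (LINT z|lborel. std_normal_density z *\<^sub>R v (x + \<sigma> * z))" if \<sigma>: "\<sigma> > 0" for \<sigma>
  proof -
    have "(LINT y|lebesgue. v y * of_real (normal_density x \<sigma> y)) = (LINT y|lborel. v y * of_real (normal_density x \<sigma> y))"
      by (simp add: integral_completion)
    also have "\<dots> = \<bar>\<sigma>\<bar> *\<^sub>R (LINT z|lborel. v (x + \<sigma> * z) * of_real (normal_density x \<sigma> (x + \<sigma> * z)))"
      using \<sigma> by (intro lborel_integral_real_affine) auto
    also have "\<dots> = (LINT z|lborel. \<sigma> *\<^sub>R (v (x + \<sigma> * z) * of_real (normal_density x \<sigma> (x + \<sigma> * z))))"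
      using \<sigma> by (simp del: integral_scaleR_right flip: integral_scaleR_right)
    also have "\<dots> = (LINT z|lborel. std_normal_density z *\<^sub>R v (x + \<sigma> * z))"
    proof (intro Bochner_Integration.integral_cong refl)
      fix z
      have "\<sigma> * normal_density x \<sigma> (x + \<sigma> * z) = std_normal_density z"
        using \<sigma> by (simp add: normal_density_def real_sqrt_mult field_simps)
      then show "\<sigma> *\<^sub>R (v (x + \<sigma> * z) * of_real (normal_density x \<sigma> (x + \<sigma> * z))) = std_normal_density z *\<^sub>R v (x + \<sigma> * z)"
        by (simp add: scaleR_conv_of_real flip: of_real_mult)
    qed
    finally show ?thesis .
  qed
  have "(\<lambda>n. LINT z|lborel. std_normal_density z *\<^sub>R v (x + inverse (real (Suc n)) * z)) \<longlonglongrightarrow>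
      (LINT z|lborel. std_normal_density z *\<^sub>R v x)"
  proof (rule integral_dominated_convergence[where w="\<lambda>z. std_normal_density z * B"])
    have "isCont v x" for x using cont by (simp add: continuous_on_eq_continuous_at)
    moreover have "(\<lambda>n. x + inverse (real (Suc n)) * z) \<longlonglongrightarrow> x + 0 * z" for z
      by (intro tendsto_intros LIMSEQ_inverse_real_of_nat)
    ultimately have "(\<lambda>n. v (x + inverse (real (Suc n)) * z)) \<longlonglongrightarrow> v x" for z
      by (intro isCont_tendsto_compose[of x v]) simp_all
    then show "AE z in lborel. (\<lambda>n. std_normal_density z *\<^sub>R v (x + inverse (real (Suc n)) * z)) \<longlonglongrightarrow> std_normal_density z *\<^sub>R v x"
      by (intro AE_I2 tendsto_scaleR tendsto_const)
    show "AE z in lborel. norm (std_normal_density z *\<^sub>R v (x + inverse (real (Suc n)) * z)) \<le> std_normal_density z * B" for n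
      using bdd by (intro AE_I2) (simp add: mult_left_mono)
  qed (auto intro!: integrable_mult_left integrable_normal_density)
  also have "(LINT z|lborel. std_normal_density z *\<^sub>R v x) = v x"
    by (simp add: integral_normal_density)
  finally show ?thesis by (simp add: eq)
qed

text \<open>The full Plancherel identity, but tested only against continuous bounded \<open>v\<close>, for which the
  Gaussian smoothing converges pointwise.  Such test functions suffice to identify an \<open>L\<^sup>2\<close> function.\<close>
lemma plancherel_weak:
  fixes u v :: "real \<Rightarrow> complex"
  assumes u: "u \<in> L2" "integrable lebesgue u" and c: "\<bar>c\<bar> = 1"
    and v: "v \<in> L2" "integrable lebesgue v" "continuous_on UNIV v" "\<And>x. cmod (v x) \<le> B"
  shows "(LINT \<xi>|lebesgue. osc c u \<xi> * osc (-c) v \<xi>) = 2 * pi * (LINT x|lebesgue. u x * v x)"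
proof -
  note [measurable] = L2_measurable[OF u(1)] L2_measurable[OF v(1)]
  have c': "\<bar>- c\<bar> = 1" using c by simp
  let ?s = "\<lambda>n. inverse (real (Suc n))"
  have B: "0 \<le> B" using v(4)[of 0] norm_ge_zero[of "v 0"] by linarith
  have "(\<lambda>n. LINT \<xi>|lebesgue. osc c u \<xi> * (osc (-c) v \<xi> * gauss (?s n) \<xi>)) \<longlonglongrightarrow>
      (LINT \<xi>|lebesgue. osc c u \<xi> * (osc (-c) v \<xi> * 1))"
  proof (rule integral_dominated_convergence[where w="\<lambda>\<xi>. cmod (osc c u \<xi> * osc (-c) v \<xi>)"])
    show "integrable lebesgue (\<lambda>\<xi>. cmod (osc c u \<xi> * osc (-c) v \<xi>))"
      by (intro integrable_norm L2_mult_integrable osc_L2 u v(1,2) c c')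
    have "(\<lambda>n. gauss (?s n) \<xi>) \<longlonglongrightarrow> of_real (exp (- (0 * \<xi>)\<^sup>2 / 2))" for \<xi>
      unfolding gauss_def by (intro tendsto_intros LIMSEQ_inverse_real_of_nat) auto
    then show "AE \<xi> in lebesgue. (\<lambda>n. osc c u \<xi> * (osc (-c) v \<xi> * gauss (?s n) \<xi>)) \<longlonglongrightarrow> osc c u \<xi> * (osc (-c) v \<xi> * 1)"
      by (intro AE_I2 tendsto_mult tendsto_const) simp
    show "AE \<xi> in lebesgue. norm (osc c u \<xi> * (osc (-c) v \<xi> * gauss (?s n) \<xi>)) \<le> cmod (osc c u \<xi> * osc (-c) v \<xi>)" for n
      by (intro AE_I2) (auto simp: norm_mult gauss_def intro!: mult_left_mono mult_left_le)
  qed measurable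
  moreover have "(\<lambda>n. LINT x|lebesgue. u x * (LINT y|lebesgue. v y * of_real (normal_density x (?s n) y))) \<longlonglongrightarrow>
      (LINT x|lebesgue. u x * v x)"
  proof (rule integral_dominated_convergence[where w="\<lambda>x. cmod (u x) * B"])
    show "AE x in lebesgue. (\<lambda>n. u x * (LINT y|lebesgue. v y * of_real (normal_density x (?s n) y))) \<longlonglongrightarrow> u x * v x"
      by (intro AE_I2 tendsto_mult tendsto_const gauss_smoothing_tendsto[OF v(3,4)])
    have "cmod (LINT y|lebesgue. v y * of_real (normal_density x \<sigma> y)) \<le> B" if \<sigma>: "\<sigma> > 0" for x \<sigma>
    proof -
      have "cmod (LINT y|lebesgue. v y * of_real (normal_density x \<sigma> y)) \<le> (LINT y|lebesgue. B * normal_density x \<sigma> y)"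
        using v(4) normal_density_integrable_lebesgue[OF \<sigma>, of x]
        by (intro Bochner_Integration.integral_norm_bound_integral[OF Bochner_Integration.integrable_bound[of _ "\<lambda>y. B * normal_density x \<sigma> y"]])
           (auto simp: norm_mult B intro!: mult_right_mono)
      also have "\<dots> = B"
        using integral_normal_density[OF \<sigma>, of x] by (simp add: integral_completion)
      finally show ?thesis .
    qed
    then show "AE x in lebesgue. norm (u x * (LINT y|lebesgue. v y * of_real (normal_density x (?s n) y))) \<le> cmod (u x) * B" for n
      by (intro AE_I2) (auto simp: norm_mult intro!: mult_left_mono)
    show "(\<lambda>x. u x * (LINT y|lebesgue. v y * of_real (normal_density x (?s n) y))) \<in> borel_measurable lebesgue" for n
      unfolding normal_density_def by measurable
  qed (use u(2) in auto)
  then have "(\<lambda>n. 2 * pi * (LINT x|lebesgue. u x * (LINT y|lebesgue. v y * of_real (normal_density x (?s n) y)))) \<longlonglongrightarrow>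
      2 * pi * (LINT x|lebesgue. u x * v x)"
    by (intro tendsto_mult tendsto_const)
  ultimately show ?thesis
    by (simp add: osc_gauss_pairing[OF u(2) v(2) _ c] LIMSEQ_unique)
qed

section \<open>The Fourier transform on square-integrable functions\<close>

text \<open>Riesz-Fischer, in a form that gives the rate: a subsequence with geometrically small increments
  converges almost everywhere, and Fatou's lemma transfers the Cauchy bound \<open>r\<close> to the limit.\<close>
lemma L2_complete:
  fixes r :: "real \<Rightarrow> ennreal"
  assumes U: "\<And>N. U N \<in> L2"
    and cauchy: "\<And>N M. N \<le> M \<Longrightarrow> l2sq (\<lambda>x. U M x - U N x) \<le> r N"
    and r: "(r \<longlongrightarrow> 0) at_top"
  obtains g where "g \<in> L2" "\<And>N. l2sq (\<lambda>x. U N x - g x) \<le> r N"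
proof -
  have [measurable]: "U N \<in> borel_measurable lebesgue" for N using U by (rule L2_measurable)
  have "\<exists>N. real k \<le> N \<and> r N \<le> ennreal ((1 / 8) ^ k)" for k
  proof -
    have "eventually (\<lambda>N. r N < ennreal ((1 / 8) ^ k)) at_top"
      using r by (rule order_tendstoD(2)) (simp add: ennreal_zero_less_mult_iff flip: ennreal_0 add: ennreal_less_iff)
    then have "eventually (\<lambda>N. real k \<le> N \<and> r N < ennreal ((1 / 8) ^ k)) at_top"
      using eventually_ge_at_top[of "real k"] by eventually_elim simp
    then show ?thesis
      unfolding eventually_at_top_linorder by (meson less_imp_le order_refl)
  qed
  \<comment> \<open>Any ratio below \<open>1 / 2\<close> would do: the increments are weighted by \<open>2 ^ k\<close> below, and the weighted squares must remain summable.\<close>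
  then obtain X where X: "\<And>k. real k \<le> X k" "\<And>k. r (X k) \<le> ennreal ((1 / 8) ^ k)" by metis
  define d where "d k x = U (X (Suc k)) x - U (X k) x" for k x
  have d [measurable]: "d k \<in> borel_measurable lebesgue" for k unfolding d_def by measurable
  have d_le: "l2sq (d k) \<le> ennreal ((1 / 8) ^ k)" for k
  proof (cases "X k \<le> X (Suc k)")
    case True
    then show ?thesis using cauchy[OF True] X(2)[of k] unfolding d_def by (blast intro: order_trans)
  next
    case False
    then have "l2sq (d k) \<le> r (X (Suc k))"
      unfolding d_def by (subst l2sq_minus_commute) (intro cauchy, simp)
    also have "\<dots> \<le> ennreal ((1 / 8) ^ Suc k)" by (rule X(2))
    also have "\<dots> \<le> ennreal ((1 / 8) ^ k)" by (intro ennreal_leI power_decreasing) auto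
    finally show ?thesis .
  qed
  have "(\<integral>\<^sup>+x. (\<Sum>k. ennreal (2 ^ k * (cmod (d k x))\<^sup>2)) \<partial>lebesgue) = (\<Sum>k. ennreal (2 ^ k) * l2sq (d k))"
    unfolding l2sq_def by (subst nn_integral_suminf) (simp_all add: ennreal_mult nn_integral_cmult)
  also have "\<dots> \<le> (\<Sum>k. ennreal ((1 / 4) ^ k))"
  proof (intro suminf_le summableI)
    fix k
    have "ennreal (2 ^ k) * l2sq (d k) \<le> ennreal (2 ^ k) * ennreal ((1 / 8) ^ k)"
      by (intro mult_left_mono d_le) simp
    also have "\<dots> = ennreal ((1 / 4) ^ k)"
      by (simp flip: ennreal_mult power_mult_distrib)
    finally show "ennreal (2 ^ k) * l2sq (d k) \<le> ennreal ((1 / 4) ^ k)" .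
  qed
  also have "\<dots> < \<infinity>"
    by (subst suminf_ennreal2) (auto intro!: summable_geometric)
  finally have "AE x in lebesgue. (\<Sum>k. ennreal (2 ^ k * (cmod (d k x))\<^sup>2)) \<noteq> \<infinity>"
    by (intro nn_integral_PInf_AE) auto
  then have conv: "AE x in lebesgue. convergent (\<lambda>k. U (X k) x)"
  proof (rule AE_mp, intro AE_I2 impI)
    fix x assume fin: "(\<Sum>k. ennreal (2 ^ k * (cmod (d k x))\<^sup>2)) \<noteq> \<infinity>"
    then have summ: "summable (\<lambda>k. 2 ^ k * (cmod (d k x))\<^sup>2)"
      by (intro summable_suminf_not_top) auto
    then obtain B where B: "\<And>k. 2 ^ k * (cmod (d k x))\<^sup>2 \<le> B"
      using summable_imp_Bseq[OF summ] by (auto simp: Bseq_def)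
    have "cmod (d k x) \<le> sqrt B * (1 / sqrt 2) ^ k" for k
    proof -
      have "cmod (d k x) = sqrt (2 ^ k * (cmod (d k x))\<^sup>2) * (1 / sqrt 2) ^ k"
        by (simp add: real_sqrt_mult real_sqrt_power power_divide)
      also have "\<dots> \<le> sqrt B * (1 / sqrt 2) ^ k"
        using B by (intro mult_right_mono) auto
      finally show ?thesis .
    qed
    moreover have "summable (\<lambda>k. sqrt B * (1 / sqrt 2) ^ k)"
      by (rule summable_mult, rule summable_geometric) simp
    ultimately have "summable (\<lambda>k. d k x)"
      by (rule summable_comparison_test'[rotated])
    then have "convergent (\<lambda>n. \<Sum>k<n. d k x)"
      by (simp only: summable_iff_convergent)
    then have "convergent (\<lambda>n. U (X 0) x + (\<Sum>k<n. d k x))"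
      by (rule convergent_add[OF convergent_const])
    then show "convergent (\<lambda>k. U (X k) x)"
      unfolding d_def by (simp add: sum_lessThan_telescope[of "\<lambda>k. U (X k) x"])
  qed
  define g where "g x = lim (\<lambda>k. U (X k) x)" for x
  have g [measurable]: "g \<in> borel_measurable lebesgue"
    unfolding g_def by measurable
  have le: "l2sq (\<lambda>x. U N x - g x) \<le> r N" for N
  proof -
    have "l2sq (\<lambda>x. U N x - g x) = (\<integral>\<^sup>+x. liminf (\<lambda>k. ennreal ((cmod (U N x - U (X k) x))\<^sup>2)) \<partial>lebesgue)"
      unfolding l2sq_def
    proof (rule nn_integral_cong_AE, rule AE_mp[OF conv], intro AE_I2 impI)
      fix x assume "convergent (\<lambda>k. U (X k) x)"
      then have "(\<lambda>k. U (X k) x) \<longlonglongrightarrow> g x" by (simp add: convergent_LIMSEQ_iff g_def)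
      then have "(\<lambda>k. ennreal ((cmod (U N x - U (X k) x))\<^sup>2)) \<longlonglongrightarrow> ennreal ((cmod (U N x - g x))\<^sup>2)"
        by (intro tendsto_intros tendsto_ennrealI)
      then show "ennreal ((cmod (U N x - g x))\<^sup>2) = liminf (\<lambda>k. ennreal ((cmod (U N x - U (X k) x))\<^sup>2))"
        by (rule lim_imp_Liminf[OF trivial_limit_sequentially, symmetric])
    qed
    also have "\<dots> \<le> liminf (\<lambda>k. \<integral>\<^sup>+x. ennreal ((cmod (U N x - U (X k) x))\<^sup>2) \<partial>lebesgue)"
      by (rule nn_integral_liminf) measurable
    also have "\<dots> = liminf (\<lambda>k. l2sq (\<lambda>x. U (X k) x - U N x))"
      by (simp add: l2sq_def norm_minus_commute)
    also have "\<dots> \<le> r N"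
    proof (rule Liminf_le, rule trivial_limit_sequentially)
      have "eventually (\<lambda>k. N \<le> real k) sequentially"
        using filterlim_real_sequentially unfolding filterlim_at_top by blast
      then show "eventually (\<lambda>k. l2sq (\<lambda>x. U (X k) x - U N x) \<le> r N) sequentially"
        by eventually_elim (use X(1) in \<open>blast intro: cauchy order_trans\<close>)
    qed
    finally show ?thesis .
  qed
  have "r (X 0) < \<infinity>" using X(2)[of 0] by (auto intro: le_less_trans)
  then have "(\<lambda>x. U (X 0) x - g x) \<in> L2"
    unfolding L2_iff using le[of "X 0"] by (auto intro: le_less_trans)
  from L2_diff[OF U[of "X 0"] this] have "g \<in> L2" by simp
  with le that show ?thesis by blast
qed

lemma L2_limit_unique:
  assumes U: "\<And>N. U N \<in> borel_measurable lebesgue" and g: "g \<in> L2" "g' \<in> L2"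
    and lim: "((\<lambda>N. l2sq (\<lambda>x. U N x - g x)) \<longlongrightarrow> 0) F" "((\<lambda>N. l2sq (\<lambda>x. U N x - g' x)) \<longlongrightarrow> 0) F"
    and F: "F \<noteq> bot"
  shows "AE x in lebesgue. g x = g' x"
proof -
  note [measurable] = U g[THEN L2_measurable]
  have "((\<lambda>N. 2 * l2sq (\<lambda>x. U N x - g x) + 2 * l2sq (\<lambda>x. U N x - g' x)) \<longlongrightarrow> 2 * 0 + 2 * 0) F"
    using lim by (intro tendsto_add tendsto_mult_ennreal tendsto_const) auto
  moreover have "l2sq (\<lambda>x. g x - g' x) \<le> 2 * l2sq (\<lambda>x. U N x - g x) + 2 * l2sq (\<lambda>x. U N x - g' x)" for N
    using l2sq_triangle[of g "U N" g'] g U by (simp add: l2sq_minus_commute[of g])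
  ultimately have "l2sq (\<lambda>x. g x - g' x) \<le> 2 * 0 + 2 * 0"
    using F by (intro tendsto_lowerbound[OF _ always_eventually]) auto
  then have "l2sq (\<lambda>x. g x - g' x) = 0" by simp
  then have "AE x in lebesgue. ennreal ((cmod (g x - g' x))\<^sup>2) = 0"
    unfolding l2sq_def by (subst (asm) nn_integral_0_iff_AE) auto
  then show ?thesis by eventually_elim simp
qed

text \<open>\<open>g\<close> is the \<open>L\<^sup>2\<close> transform of \<open>u\<close>: the mean-square limit of the transforms of the truncations
  of \<open>u\<close>.  For \<open>c = -1\<close> this is \<open>has_fourier_transform u g\<close>.\<close>
definition osc_lim :: "real \<Rightarrow> (real \<Rightarrow> complex) \<Rightarrow> (real \<Rightarrow> complex) \<Rightarrow> bool" where
  "osc_lim c u g \<longleftrightarrow> g \<in> L2 \<and> ((\<lambda>N. l2sq (\<lambda>\<xi>. osc c (trunc N u) \<xi> - g \<xi>)) \<longlongrightarrow> 0) at_top"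

lemma osc_trunc_L2: "u \<in> L2 \<Longrightarrow> \<bar>c\<bar> = 1 \<Longrightarrow> osc c (trunc N u) \<in> L2"
  by (intro osc_L2 trunc_L2 trunc_integrable)

lemma osc_lim_unique:
  assumes "u \<in> L2" "\<bar>c\<bar> = 1" "osc_lim c u g" "osc_lim c u g'"
  shows "AE x in lebesgue. g x = g' x"
  using assms unfolding osc_lim_def
  by (intro L2_limit_unique[where F=at_top and U="\<lambda>N. osc c (trunc N u)"] osc_measurable trunc_measurable L2_measurable) auto

lemma osc_lim_exists:
  assumes u: "u \<in> L2" and c: "\<bar>c\<bar> = 1"
  obtains g where "osc_lim c u g"
proof -
  let ?r = "\<lambda>N. ennreal (2 * pi) * l2sq (\<lambda>x. trunc N u x - u x)"
  have r: "(?r \<longlongrightarrow> 0) at_top"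
    using tendsto_mult_ennreal[OF tendsto_const trunc_tendsto_L2[OF u], of "ennreal (2 * pi)"] by simp
  obtain g where g: "g \<in> L2" "\<And>N. l2sq (\<lambda>\<xi>. osc c (trunc N u) \<xi> - g \<xi>) \<le> ?r N"
  proof (rule L2_complete[OF osc_trunc_L2[OF u c] _ r])
    fix N M :: real assume "N \<le> M"
    have "l2sq (\<lambda>\<xi>. osc c (trunc M u) \<xi> - osc c (trunc N u) \<xi>) = l2sq (osc c (\<lambda>x. trunc M u x - trunc N u x))"
      by (simp add: osc_diff[OF trunc_integrable[OF u] trunc_integrable[OF u], symmetric, abs_def])
    also have "\<dots> \<le> ennreal (2 * pi) * l2sq (\<lambda>x. trunc M u x - trunc N u x)"
      using u by (intro osc_L2_bound L2_diff trunc_L2 Bochner_Integration.integrable_diff trunc_integrable c)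
    also have "\<dots> \<le> ?r N"
      using \<open>N \<le> M\<close> by (intro mult_left_mono l2sq_mono) (auto simp: trunc_def)
    finally show "l2sq (\<lambda>\<xi>. osc c (trunc M u) \<xi> - osc c (trunc N u) \<xi>) \<le> ?r N" .
  qed blast
  have "((\<lambda>N. l2sq (\<lambda>\<xi>. osc c (trunc N u) \<xi> - g \<xi>)) \<longlongrightarrow> 0) at_top"
    by (rule tendsto_sandwich[OF _ _ tendsto_const r]) (use g in auto)
  with g that show ?thesis by (auto simp: osc_lim_def)
qed

text \<open>The test function that detects \<open>d\<close> is \<open>sgn (cnj d)\<close>, cut off to a bounded interval.  It is a limit
  almost everywhere of continuous functions, which are made bounded and compactly
  supported so that dominated convergence applies.\<close>
lemma AE_zero_if_orthogonal_to_continuous: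
  assumes d: "d \<in> L2"
    and orth: "\<And>v M. \<lbrakk>continuous_on UNIV v; \<And>x. cmod (v x) \<le> indicator {-M..M} x\<rbrakk> \<Longrightarrow>
      (LINT x|lebesgue. d x * v x) = 0"
  shows "AE x in lebesgue. d x = 0"
proof -
  note [measurable] = L2_measurable[OF d]
  have "AE x in lebesgue. trunc (real n) d x = 0" for n
  proof -
    define s where "s = trunc (real n) (\<lambda>x. sgn (cnj (d x)))"
    have [measurable]: "s \<in> borel_measurable lebesgue" unfolding s_def sgn_div_norm by measurable
    have s_le: "cmod (s x) \<le> 1" for x by (simp add: s_def trunc_def norm_sgn)
    have "s measurable_on UNIV" by (intro lebesgue_measurable_imp_measurable_on) auto
    then obtain N v where N: "negligible N" and v: "\<And>k. continuous_on UNIV (v k)"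
      and vs: "\<And>x. x \<notin> N \<Longrightarrow> (\<lambda>k. v k x) \<longlonglongrightarrow> s x"
      by (auto simp: measurable_on_def)
    \<comment> \<open>Radial retraction onto the unit disc, which contains all values of \<open>s\<close>.\<close>
    define clip :: "complex \<Rightarrow> complex" where "clip z = z /\<^sub>R max 1 (cmod z)" for z
    \<comment> \<open>The ramp equals one on \<open>[-n, n]\<close>, where \<open>s\<close> lives, and vanishes outside \<open>[-n-1, n+1]\<close>.\<close>
    define \<eta> :: "real \<Rightarrow> real" where "\<eta> x = max 0 (min 1 (real n + 1 - \<bar>x\<bar>))" for x
    define w where "w k x = \<eta> x *\<^sub>R clip (v k x)" for k x
    have clip_le: "cmod (clip z) \<le> 1" for z
      unfolding clip_def by (simp add: divide_simps)
    have clip_cont: "continuous_on UNIV clip"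
      unfolding clip_def by (intro continuous_intros) auto
    have \<eta>_cont: "continuous_on UNIV \<eta>"
      unfolding \<eta>_def by (intro continuous_intros)
    have w_cont: "continuous_on UNIV (w k)" for k
      unfolding w_def using continuous_on_compose2[OF clip_cont v[of k]]
      by (intro continuous_on_scaleR \<eta>_cont) auto
    have w_le: "cmod (w k x) \<le> indicator {-(real n + 1)..real n + 1} x" for k x
      using clip_le[of "v k x"] mult_mono[of "\<eta> x" 1 "cmod (clip (v k x))" 1]
      by (cases "\<bar>x\<bar> \<le> real n + 1") (auto simp: w_def \<eta>_def abs_le_iff indicator_def)
    have w_lim: "(\<lambda>k. w k x) \<longlonglongrightarrow> s x" if "x \<notin> N" for x
    proof -
      have "isCont clip (s x)" using clip_cont by (simp add: continuous_on_eq_continuous_at)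
      then have "(\<lambda>k. clip (v k x)) \<longlonglongrightarrow> clip (s x)"
        using vs[OF that] by (rule isCont_tendsto_compose)
      then have "(\<lambda>k. w k x) \<longlonglongrightarrow> \<eta> x *\<^sub>R clip (s x)"
        unfolding w_def by (intro tendsto_intros)
      also have "\<eta> x *\<^sub>R clip (s x) = s x"
        using s_le[of x] by (auto simp: clip_def max_def \<eta>_def s_def trunc_def)
      finally show ?thesis .
    qed
    have "(\<lambda>k. LINT x|lebesgue. d x * w k x) \<longlonglongrightarrow> (LINT x|lebesgue. d x * s x)"
    proof (rule integral_dominated_convergence[where w="\<lambda>x. cmod (d x * indicator {-(real n + 1)..real n + 1} x)"])
      show "integrable lebesgue (\<lambda>x. cmod (d x * indicator {-(real n + 1)..real n + 1} x))"
        by (intro integrable_norm L2_mult_integrable d indicator_L2)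
      have "AE x in lebesgue. x \<notin> N"
        using N by (simp add: AE_not_in negligible_iff_null_sets)
      then show "AE x in lebesgue. (\<lambda>k. d x * w k x) \<longlonglongrightarrow> d x * s x"
        by eventually_elim (intro tendsto_mult tendsto_const w_lim)
      show "AE x in lebesgue. norm (d x * w k x) \<le> cmod (d x * indicator {-(real n + 1)..real n + 1} x)" for k
      proof (rule AE_I2)
        fix x show "norm (d x * w k x) \<le> cmod (d x * indicator {-(real n + 1)..real n + 1} x)"
          using w_le[of k x] by (cases "x \<in> {-(real n + 1)..real n + 1}") (auto simp: norm_mult intro: mult_left_le)
      qed
      have [measurable]: "w k \<in> borel_measurable lebesgue" for k
        using borel_measurable_continuous_onI[OF w_cont[of k]] by (intro measurable_completion) simp
      show "(\<lambda>x. d x * w k x) \<in> borel_measurable lebesgue" for k by measurable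
    qed measurable
    then have "(LINT x|lebesgue. d x * s x) = 0"
      using orth[OF w_cont w_le] by (simp add: LIMSEQ_const_iff)
    also have "(\<lambda>x. d x * s x) = (\<lambda>x. of_real (cmod (trunc (real n) d x)))"
    proof (rule ext)
      fix x
      have "z * sgn (cnj z) = of_real (cmod z)" for z :: complex
        by (cases "z = 0") (simp_all add: sgn_div_norm scaleR_conv_of_real divide_simps complex_norm_square[symmetric] power2_eq_square flip: of_real_mult)
      then show "d x * s x = of_real (cmod (trunc (real n) d x))"
        by (simp add: s_def trunc_def)
    qed
    finally have "(LINT x|lebesgue. cmod (trunc (real n) d x)) = 0"
      by (simp add: integral_of_real[OF integrable_norm[OF trunc_integrable[OF d]]])
    then have "AE x in lebesgue. cmod (trunc (real n) d x) = 0"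
      by (subst (asm) integral_nonneg_eq_0_iff_AE) (auto intro: integrable_norm trunc_integrable d)
    then show ?thesis by simp
  qed
  then have "AE x in lebesgue. \<forall>n. trunc (real n) d x = 0"
    by (simp add: AE_all_countable)
  then show ?thesis
  proof eventually_elim
    case (elim x)
    obtain n where "\<bar>x\<bar> \<le> real n" using real_arch_simple by blast
    then show ?case using elim[rule_format, of n] by (simp add: trunc_def)
  qed
qed

lemma L2_if_le_indicator:
  assumes [measurable]: "v \<in> borel_measurable lebesgue" and le: "\<And>x. cmod (v x) \<le> indicator {-M..M} x"
  shows "v \<in> L2" "integrable lebesgue v"
proof -
  have "l2sq v \<le> l2sq (\<lambda>x. indicator {-M..M} x)"
  proof (rule l2sq_mono)
    fix x show "cmod (v x) \<le> cmod (indicator {-M..M} x)"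
      using le[of x] by (cases "x \<in> {-M..M}") auto
  qed
  with l2sq_finite[OF indicator_L2[of M]] show v: "v \<in> L2"
    by (auto simp: L2_iff intro: le_less_trans)
  have "trunc M v = v"
  proof (rule ext)
    fix x show "trunc M v x = v x"
      using le[of x] by (auto simp: trunc_def indicator_def abs_le_iff split: if_splits)
  qed
  with trunc_integrable[OF v, of M] show "integrable lebesgue v" by simp
qed

text \<open>Let \<open>u'\<close> be the backward transform of \<open>g\<close>, which exists by completeness.  For a continuous test
  function \<open>v\<close>, the multiplication formula gives that the pairing of \<open>u'\<close> with \<open>v\<close> is the pairing of \<open>g\<close> with the
  backward transform of \<open>v\<close>; by the weak Plancherel identity the latter is \<open>2 * pi\<close> times the pairing of \<open>u\<close>
  with \<open>v\<close>.  Hence \<open>u' = 2 * pi * u\<close> almost everywhere.\<close>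
lemma osc_inversion:
  fixes u :: "real \<Rightarrow> complex"
  assumes u: "u \<in> L2" and c: "\<bar>c\<bar> = 1" and g: "osc_lim c u g"
  shows "osc_lim (-c) g (\<lambda>x. 2 * pi * u x)"
proof -
  have gL: "g \<in> L2" and glim: "((\<lambda>N. l2sq (\<lambda>\<xi>. osc c (trunc N u) \<xi> - g \<xi>)) \<longlongrightarrow> 0) at_top"
    using g by (auto simp: osc_lim_def)
  have c': "\<bar>- c\<bar> = 1" using c by simp
  obtain u' where u': "osc_lim (-c) g u'" using osc_lim_exists[OF gL c'] .
  then have u'L: "u' \<in> L2" by (simp add: osc_lim_def)
  have uL: "(\<lambda>x. 2 * pi * u x) \<in> L2" using u by (rule L2_cmult)
  have "AE x in lebesgue. u' x - 2 * pi * u x = 0"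
  proof (rule AE_zero_if_orthogonal_to_continuous)
    show "(\<lambda>x. u' x - 2 * pi * u x) \<in> L2" using u'L uL by (rule L2_diff)
    fix v :: "real \<Rightarrow> complex" and M
    assume cont: "continuous_on UNIV v" and le: "\<And>x. cmod (v x) \<le> indicator {-M..M} x"
    have vm [measurable]: "v \<in> borel_measurable lebesgue"
      using borel_measurable_continuous_onI[OF cont] by (intro measurable_completion) simp
    note v = L2_if_le_indicator[OF vm le]
    have v1: "cmod (v x) \<le> 1" for x using le[of x] by (rule order_trans) (simp add: indicator_def)
    note Kv = osc_L2[OF v c']
    have "((\<lambda>N. LINT x|lebesgue. osc (-c) (trunc N g) x * v x) \<longlongrightarrow> (LINT x|lebesgue. u' x * v x)) at_top"
      using u' by (intro L2_tendsto_integral osc_trunc_L2 gL c' u'L v) (simp add: osc_lim_def)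
    moreover have "(\<lambda>N. LINT x|lebesgue. osc (-c) (trunc N g) x * v x) = (\<lambda>N. LINT x|lebesgue. trunc N g x * osc (-c) v x)"
      by (intro ext osc_multiplication_formula trunc_integrable gL v)
    ultimately have "((\<lambda>N. LINT x|lebesgue. trunc N g x * osc (-c) v x) \<longlongrightarrow> (LINT x|lebesgue. u' x * v x)) at_top"
      by (simp only:)
    moreover have "((\<lambda>N. LINT x|lebesgue. trunc N g x * osc (-c) v x) \<longlongrightarrow> (LINT x|lebesgue. g x * osc (-c) v x)) at_top"
      by (intro L2_tendsto_integral trunc_L2 gL Kv trunc_tendsto_L2)
    ultimately have 1: "(LINT x|lebesgue. u' x * v x) = (LINT x|lebesgue. g x * osc (-c) v x)"
      by (rule tendsto_unique[OF trivial_limit_at_top_linorder])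
    have "((\<lambda>N. LINT x|lebesgue. osc c (trunc N u) x * osc (-c) v x) \<longlongrightarrow> (LINT x|lebesgue. g x * osc (-c) v x)) at_top"
      by (intro L2_tendsto_integral osc_trunc_L2 u c gL Kv glim)
    moreover have "(\<lambda>N. LINT x|lebesgue. osc c (trunc N u) x * osc (-c) v x) = (\<lambda>N. 2 * pi * (LINT x|lebesgue. trunc N u x * v x))"
      using trunc_L2[OF u] trunc_integrable[OF u] c v cont v1 by (intro ext plancherel_weak)
    ultimately have "((\<lambda>N. 2 * pi * (LINT x|lebesgue. trunc N u x * v x)) \<longlongrightarrow> (LINT x|lebesgue. g x * osc (-c) v x)) at_top"
      by (simp only:)
    moreover have "((\<lambda>N. 2 * pi * (LINT x|lebesgue. trunc N u x * v x)) \<longlongrightarrow> 2 * pi * (LINT x|lebesgue. u x * v x)) at_top"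
      by (intro tendsto_mult tendsto_const L2_tendsto_integral trunc_L2 u v trunc_tendsto_L2)
    ultimately have 2: "(LINT x|lebesgue. g x * osc (-c) v x) = 2 * pi * (LINT x|lebesgue. u x * v x)"
      by (rule tendsto_unique[OF trivial_limit_at_top_linorder])
    have "(LINT x|lebesgue. (u' x - 2 * pi * u x) * v x) = (LINT x|lebesgue. u' x * v x - 2 * pi * (u x * v x))"
      by (simp add: algebra_simps)
    also have "\<dots> = (LINT x|lebesgue. u' x * v x) - 2 * pi * (LINT x|lebesgue. u x * v x)"
      by (subst Bochner_Integration.integral_diff)
         (auto intro!: integrable_mult_right L2_mult_integrable u u'L v)
    also have "\<dots> = 0" by (simp add: 1 2)
    finally show "(LINT x|lebesgue. (u' x - 2 * pi * u x) * v x) = 0" .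
  qed
  then have AE: "AE x in lebesgue. u' x = 2 * pi * u x" by eventually_elim simp
  have "l2sq (\<lambda>\<xi>. osc (-c) (trunc N g) \<xi> - u' \<xi>) = l2sq (\<lambda>\<xi>. osc (-c) (trunc N g) \<xi> - 2 * pi * u \<xi>)" for N
    by (rule l2sq_cong_AE, rule AE_mp[OF AE], rule AE_I2) simp
  with u' uL show ?thesis by (simp add: osc_lim_def)
qed

lemma has_fourier_transform_iff: "has_fourier_transform f g \<longleftrightarrow> osc_lim (-1) f g"
proof -
  have "(LINT x:{-N..N}|lebesgue. exp (- (\<i> * of_real x * of_real \<xi>)) * f x) = osc (-1) (trunc N f) \<xi>" for N \<xi>
    unfolding osc_def set_lebesgue_integral_def trunc_def
    by (intro Bochner_Integration.integral_cong) (auto simp: cis_conv_exp indicator_def abs_le_iff mult.assoc)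
  then show ?thesis
    by (simp add: has_fourier_transform_def osc_lim_def l2sq_def)
qed

text \<open>The chosen representative \<open>fourier f\<close> is a genuine transform, since one exists.\<close>
lemma fourier_osc_lim:
  assumes "f \<in> L2"
  shows "osc_lim (-1) f (fourier f)"
proof -
  obtain g where "osc_lim (-1) f g" using osc_lim_exists[OF assms, of "-1"] by auto
  then have "has_fourier_transform f (fourier f)"
    unfolding fourier_def has_fourier_transform_iff[symmetric] by (rule someI[of "has_fourier_transform f"])
  then show ?thesis by (simp add: has_fourier_transform_iff)
qed

lemma fourier_inversion:
  fixes f :: "real \<Rightarrow> complex"
  assumes "f \<in> L2"
  shows "osc_lim 1 (fourier f) (\<lambda>x. 2 * pi * f x)"
  using osc_inversion[OF assms _ fourier_osc_lim[OF assms]] by simp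

section \<open>Inverse transforms of band-limited functions\<close>

text \<open>The inverse Fourier integral.  It is defined pointwise, with no null set to be
  discarded, which matters since it is evaluated along the curves \<open>t \<mapsto> \<Gamma> x t\<close>.\<close>
definition ift :: "(real \<Rightarrow> complex) \<Rightarrow> real \<Rightarrow> complex" where
  "ift G x = 1 / (2 * pi) * osc 1 G x"

lemma osc_cmult: "osc c (\<lambda>x. k * u x) \<xi> = k * osc c u \<xi>"
  unfolding osc_def by (simp flip: integral_mult_right_zero add: mult_ac)

text \<open>A band-limited \<open>G\<close> is, almost everywhere, the Fourier transform of the function \<open>ift G\<close>: here the
  truncated inverse integrals are eventually constant, so inversion applies to \<open>G\<close> itself.\<close>
lemma ift_fourier:
  assumes G: "G \<in> L2" and supp: "trunc L G = G"
  shows ift_L2: "ift G \<in> L2" and fourier_ift: "AE \<xi> in lebesgue. fourier (ift G) \<xi> = G \<xi>"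
    and l2sq_ift: "l2sq (ift G) \<le> l2sq G"
proof -
  have int: "integrable lebesgue G" using trunc_integrable[OF G, of L] supp by simp
  have KL: "osc 1 G \<in> L2" using G int by (rule osc_L2) simp
  then show L: "ift G \<in> L2" unfolding ift_def[abs_def] by (rule L2_cmult)
  have "eventually (\<lambda>N. l2sq (\<lambda>\<xi>. osc 1 (trunc N G) \<xi> - osc 1 G \<xi>) = 0) at_top"
    using eventually_ge_at_top[of L]
  proof eventually_elim
    case (elim N)
    have "trunc N G = G"
      using elim supp trunc_trunc[of N L G] by simp
    then show ?case by (simp add: l2sq_def)
  qed
  then have "osc_lim 1 G (osc 1 G)"
    using KL by (simp add: osc_lim_def tendsto_eventually)
  then have "osc_lim (-1) (osc 1 G) (\<lambda>x. 2 * pi * G x)"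
    using osc_inversion[OF G, of 1] by simp
  then have lim: "((\<lambda>N. l2sq (\<lambda>\<xi>. osc (-1) (trunc N (osc 1 G)) \<xi> - 2 * pi * G \<xi>)) \<longlongrightarrow> 0) at_top"
    by (simp add: osc_lim_def)
  have eq: "l2sq (\<lambda>\<xi>. osc (-1) (trunc N (ift G)) \<xi> - G \<xi>) =
      ennreal ((cmod (1 / (2 * pi)))\<^sup>2) * l2sq (\<lambda>\<xi>. osc (-1) (trunc N (osc 1 G)) \<xi> - 2 * pi * G \<xi>)" for N
  proof -
    note [measurable] = L2_measurable[OF G] L2_measurable[OF KL]
    have meas: "(\<lambda>\<xi>. osc (-1) (trunc N (osc 1 G)) \<xi> - 2 * pi * G \<xi>) \<in> borel_measurable lebesgue"
      by measurable
    have "trunc N (ift G) = (\<lambda>x. (1 / (2 * pi)) * trunc N (osc 1 G) x)"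
      by (auto simp: trunc_def ift_def fun_eq_iff)
    then have "osc (-1) (trunc N (ift G)) \<xi> = (1 / (2 * pi)) * osc (-1) (trunc N (osc 1 G)) \<xi>" for \<xi>
      by (simp only: osc_cmult)
    then have "osc (-1) (trunc N (ift G)) \<xi> - G \<xi> = (1 / (2 * pi)) * (osc (-1) (trunc N (osc 1 G)) \<xi> - 2 * pi * G \<xi>)" for \<xi>
      by (simp add: right_diff_distrib)
    then show ?thesis by (simp only: l2sq_cmult[OF meas])
  qed
  have "osc_lim (-1) (ift G) G"
    unfolding osc_lim_def eq using G tendsto_mult_ennreal[OF tendsto_const lim, of "ennreal ((cmod (1 / (2 * pi)))\<^sup>2)"]
    by simp
  then show "AE \<xi> in lebesgue. fourier (ift G) \<xi> = G \<xi>"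
    by (intro osc_lim_unique[OF L _ fourier_osc_lim[OF L]]) auto
  have "l2sq (ift G) = ennreal ((cmod (1 / (2 * pi)))\<^sup>2) * l2sq (osc 1 G)"
    unfolding ift_def[abs_def] using L2_measurable[OF KL] by (intro l2sq_cmult)
  also have "\<dots> \<le> ennreal ((1 / (2 * pi))\<^sup>2) * (ennreal (2 * pi) * l2sq G)"
    using osc_L2_bound[OF G int, of 1] by (intro mult_mono) (auto simp: norm_divide norm_mult)
  also have "\<dots> = ennreal (1 / (2 * pi)) * l2sq G"
  proof -
    have "(1 / (2 * pi))\<^sup>2 * (2 * pi) = 1 / (2 * pi)" by (simp add: power2_eq_square)
    moreover have "ennreal ((1 / (2 * pi))\<^sup>2) * (ennreal (2 * pi) * l2sq G) = ennreal ((1 / (2 * pi))\<^sup>2 * (2 * pi)) * l2sq G"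
      by (subst ennreal_mult) (auto simp only: mult.assoc zero_le_power2 pi_ge_zero zero_le_mult_iff zero_le_numeral)
    ultimately show ?thesis by simp
  qed
  also have "\<dots> \<le> 1 * l2sq G"
    using pi_gt3 by (intro mult_right_mono) (auto simp: divide_simps simp flip: ennreal_1 intro!: ennreal_leI)
  finally show "l2sq (ift G) \<le> l2sq G" by simp
qed

lemma supported_integrable: "G \<in> L2 \<Longrightarrow> trunc L G = G \<Longrightarrow> integrable lebesgue G"
  using trunc_integrable[of G L] by simp

lemma supported_mult:
  assumes G: "G \<in> L2" and supp: "trunc L G = G" and m [measurable]: "m \<in> borel_measurable lebesgue"
    and le: "\<And>\<xi>. \<bar>\<xi>\<bar> \<le> L \<Longrightarrow> cmod (m \<xi>) \<le> B"
  shows "(\<lambda>\<xi>. m \<xi> * G \<xi>) \<in> L2" "trunc L (\<lambda>\<xi>. m \<xi> * G \<xi>) = (\<lambda>\<xi>. m \<xi> * G \<xi>)"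
    "cmod (m \<xi> * G \<xi>) \<le> B * cmod (G \<xi>)"
proof -
  note [measurable] = L2_measurable[OF G]
  have zero: "G \<xi> = 0" if "\<not> \<bar>\<xi>\<bar> \<le> L" for \<xi>
    using fun_cong[OF supp, of \<xi>] that by (simp add: trunc_def)
  show le': "cmod (m \<xi> * G \<xi>) \<le> B * cmod (G \<xi>)" for \<xi>
    using le[of \<xi>] zero[of \<xi>] by (cases "\<bar>\<xi>\<bar> \<le> L") (auto simp: norm_mult intro: mult_right_mono)
  show "trunc L (\<lambda>\<xi>. m \<xi> * G \<xi>) = (\<lambda>\<xi>. m \<xi> * G \<xi>)"
    using zero by (auto simp: trunc_def fun_eq_iff)
  have "l2sq (\<lambda>\<xi>. m \<xi> * G \<xi>) \<le> l2sq (\<lambda>\<xi>. of_real B * G \<xi>)"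
    using le' by (intro l2sq_mono) (auto simp: norm_mult intro: order_trans[OF _ mult_right_mono[OF abs_ge_self]])
  then show "(\<lambda>\<xi>. m \<xi> * G \<xi>) \<in> L2"
    using l2sq_finite[OF L2_cmult[OF G, of "of_real B"]] unfolding L2_iff by (auto intro: le_less_trans)
qed

lemma ift_measurable [measurable]: "G \<in> borel_measurable lebesgue \<Longrightarrow> ift G \<in> borel_measurable lebesgue"
  unfolding ift_def[abs_def] by measurable

lemma ift_cmult: "ift (\<lambda>\<xi>. k * G \<xi>) x = k * ift G x"
  unfolding ift_def osc_cmult by simp

lemma ift_diff:
  assumes "integrable lebesgue F" "integrable lebesgue G"
  shows "ift (\<lambda>\<xi>. F \<xi> - G \<xi>) x = ift F x - ift G x"
  unfolding ift_def by (simp add: osc_diff[OF assms] right_diff_distrib)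

lemma ift_sum:
  assumes "finite I" "\<And>i. i \<in> I \<Longrightarrow> integrable lebesgue (F i)"
  shows "ift (\<lambda>\<xi>. \<Sum>i\<in>I. F i \<xi>) x = (\<Sum>i\<in>I. ift (F i) x)"
proof -
  have "osc 1 (\<lambda>\<xi>. \<Sum>i\<in>I. F i \<xi>) x = (\<Sum>i\<in>I. osc 1 (F i) x)"
    unfolding osc_def sum_distrib_left
    by (intro Bochner_Integration.integral_sum osc_integrand_integrable assms(2))
  then show ?thesis by (simp add: ift_def sum_distrib_left)
qed

lemma ift_cong_AE:
  assumes "AE \<xi> in lebesgue. F \<xi> = G \<xi>" "F \<in> borel_measurable lebesgue" "G \<in> borel_measurable lebesgue"
  shows "ift F x = ift G x"
proof -
  note [measurable] = assms(2,3)
  have "osc 1 F x = osc 1 G x"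
    unfolding osc_def by (rule integral_cong_AE) (use assms(1) in \<open>auto\<close>)
  then show ?thesis by (simp add: ift_def)
qed

lemma ift_translate: "ift G (x + d) = ift (\<lambda>\<xi>. cis (d * \<xi>) * G \<xi>) x"
proof -
  have "cis (1 * \<xi> * (x + d)) * G \<xi> = cis (1 * \<xi> * x) * (cis (d * \<xi>) * G \<xi>)" for \<xi>
    by (simp add: cis_mult algebra_simps flip: mult.assoc)
  then show ?thesis by (simp only: ift_def osc_def)
qed

lemma ift_sums:
  assumes int: "\<And>n. integrable lebesgue (F n)"
    and summ: "\<And>\<xi>. summable (\<lambda>n. cmod (F n \<xi>))" "summable (\<lambda>n. LINT \<xi>|lebesgue. cmod (F n \<xi>))"
  shows "summable (\<lambda>n. cmod (ift (F n) x))" "(\<lambda>n. ift (F n) x) sums ift (\<lambda>\<xi>. \<Sum>n. F n \<xi>) x"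
proof -
  have "cmod (osc 1 (F n) x) \<le> (LINT \<xi>|lebesgue. cmod (F n \<xi>))" for n
    by (rule norm_osc_le)
  then have "summable (\<lambda>n. cmod (osc 1 (F n) x))"
    by (intro summable_comparison_test'[OF summ(2), of 0]) auto
  then show "summable (\<lambda>n. cmod (ift (F n) x))"
    unfolding ift_def norm_mult by (rule summable_mult)
  have "(\<lambda>n. osc 1 (F n) x) sums (LINT \<xi>|lebesgue. (\<Sum>n. cis (1 * \<xi> * x) * F n \<xi>))"
    unfolding osc_def using summ
    by (intro sums_integral osc_integrand_integrable int) (auto simp: norm_mult)
  also have "(LINT \<xi>|lebesgue. (\<Sum>n. cis (1 * \<xi> * x) * F n \<xi>)) = osc 1 (\<lambda>\<xi>. \<Sum>n. F n \<xi>) x"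
    unfolding osc_def using summable_norm_cancel[OF summ(1)] by (simp add: suminf_mult)
  finally show "(\<lambda>n. ift (F n) x) sums ift (\<lambda>\<xi>. \<Sum>n. F n \<xi>) x"
    unfolding ift_def by (rule sums_mult)
qed

lemma ball_sets_lebesgue [measurable]: "ball (x::real) r \<in> sets lebesgue"
  by simp

text \<open>\<open>L\<^sup>2\<close> embeds into \<open>L\<^sup>1\<close> of a bounded interval.  The crude constant comes from the elementary
  \<open>y \<le> b + y\<^sup>2 / b\<close>.\<close>
lemma nn_integral_ball_le:
  assumes u: "u \<in> L2" and b: "b > 0" and le: "l2sq u \<le> ennreal (b\<^sup>2)" and R: "R > 0"
  shows "(\<integral>\<^sup>+x\<in>ball x0 R. ennreal (cmod (u x)) \<partial>lebesgue) \<le> ennreal ((2 * R + 1) * b)"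
proof -
  note [measurable] = L2_measurable[OF u]
  have "y \<le> b + 1 / b * y\<^sup>2" for y
  proof (cases "y \<le> b")
    case True
    have "0 \<le> 1 / b * y\<^sup>2" using b by simp
    with True show ?thesis by linarith
  next
    case False
    then have "b * y \<le> y * y" using b by (intro mult_right_mono) auto
    then have "y \<le> 1 / b * y\<^sup>2" using b by (simp add: field_simps power2_eq_square)
    then show ?thesis using b by simp
  qed
  then have "ennreal (cmod (u x)) * indicator (ball x0 R) x \<le>
      ennreal b * indicator (ball x0 R) x + ennreal (1 / b) * ennreal ((cmod (u x))\<^sup>2)" for x
    using b by (auto split: split_indicator simp flip: ennreal_mult ennreal_plus intro!: ennreal_leI)
  then have "(\<integral>\<^sup>+x\<in>ball x0 R. ennreal (cmod (u x)) \<partial>lebesgue) \<le>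
      (\<integral>\<^sup>+x. ennreal b * indicator (ball x0 R) x + ennreal (1 / b) * ennreal ((cmod (u x))\<^sup>2) \<partial>lebesgue)"
    by (rule nn_integral_mono)
  also have "\<dots> = ennreal b * emeasure lebesgue (ball x0 R) + ennreal (1 / b) * l2sq u"
    by (subst nn_integral_add) (auto simp: nn_integral_cmult l2sq_def nn_integral_cmult_indicator)
  also have "\<dots> \<le> ennreal b * ennreal (2 * R) + ennreal (1 / b) * ennreal (b\<^sup>2)"
    using R by (intro add_mono mult_left_mono le) (auto simp: ball_eq_greaterThanLessThan)
  also have "\<dots> = ennreal ((2 * R + 1) * b)"
    using b R by (simp add: power2_eq_square algebra_simps flip: ennreal_mult ennreal_plus)
  finally show ?thesis .
qed

section \<open>Short times: expansion into Fourier multipliers\<close>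

text \<open>On the frequency band \<open>\<bar>\<xi>\<bar> \<le> L\<close> the functions \<open>\<xi> / L\<close> and \<open>(\<bar>\<xi>\<bar> / L) powr a\<close> are bounded by one.  Expanding
  the exponential into its power series separates the parameters \<open>A\<close> and \<open>w\<close> (which depend on \<open>x\<close> and on
  time) from fixed Fourier multipliers of norm at most one.  The sum \<open>H\<close> of the absolute
  values of these multipliers applied to \<open>G\<close>, with the coefficients of the series, is independent
  of \<open>A\<close> and \<open>w\<close>, and its integral is controlled by the \<open>L\<^sup>2\<close> norm of \<open>G\<close>; subtracting one
  removes the constant term, which yields the factor \<open>\<tau>\<close>.  This linearises the supremum over times that are short
  relative to the frequency.\<close>
lemma taylor_majorant:
  fixes a b K L R x0 :: real
  assumes G: "G \<in> L2" and supp: "trunc L G = G" and L: "L > 0" and a: "a \<ge> 0" and K: "K \<ge> 0"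
    and b: "b > 0" and Gb: "l2sq G \<le> ennreal (b\<^sup>2)" and R: "R > 0"
  obtains H where "H \<in> borel_measurable lebesgue"
    "(\<integral>\<^sup>+x\<in>ball x0 R. H x \<partial>lebesgue) \<le> ennreal (exp (2 * K) * ((2 * R + 1) * b))"
    "\<And>x A w \<tau>. \<lbrakk>\<bar>A\<bar> \<le> K * \<tau>; cmod w \<le> K * \<tau>; 0 \<le> \<tau>; \<tau> \<le> 1\<rbrakk> \<Longrightarrow>
      ennreal (cmod (ift (\<lambda>\<xi>. (exp (\<i> * of_real A * of_real (\<xi> / L) + w * of_real ((\<bar>\<xi>\<bar> / L) powr a)) - 1) * G \<xi>) x))
        \<le> ennreal \<tau> * H x"
proof -
  note [measurable] = L2_measurable[OF G]
  define m1 where "m1 \<xi> = complex_of_real (\<xi> / L)" for \<xi>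
  define m2 where "m2 \<xi> = complex_of_real ((\<bar>\<xi>\<bar> / L) powr a)" for \<xi>
  have [measurable]: "m1 \<in> borel_measurable lebesgue" "m2 \<in> borel_measurable lebesgue"
    unfolding m1_def m2_def by measurable
  have m1_le: "cmod (m1 \<xi>) \<le> 1" and m2_le: "cmod (m2 \<xi>) \<le> 1" if "\<bar>\<xi>\<bar> \<le> L" for \<xi>
    using that L a by (auto simp: m1_def m2_def norm_divide intro!: powr_le1)
  define P where "P j l \<xi> = (m1 \<xi> ^ j * m2 \<xi> ^ l) * G \<xi>" for j l :: nat and \<xi>
  have mm: "cmod (m1 \<xi> ^ j * m2 \<xi> ^ l) \<le> 1" if "\<bar>\<xi>\<bar> \<le> L" for j l \<xi>
    using m1_le[OF that] m2_le[OF that] by (auto simp: norm_mult norm_power intro!: mult_le_one power_le_one)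
  have P: "P j l \<in> L2" "trunc L (P j l) = P j l" "cmod (P j l \<xi>) \<le> 1 * cmod (G \<xi>)" for j l \<xi>
    unfolding P_def[abs_def] by (rule supported_mult[OF G supp _ mm]; measurable)+
  have P_int: "integrable lebesgue (P j l)" for j l
    using P(1,2) by (rule supported_integrable)
  define U where "U j l = ift (P j l)" for j l
  have U: "U j l \<in> L2" and U_le: "l2sq (U j l) \<le> ennreal (b\<^sup>2)" for j l
  proof -
    show "U j l \<in> L2" unfolding U_def using P(1,2) by (rule ift_L2)
    have "l2sq (U j l) \<le> l2sq (P j l)" unfolding U_def using P(1,2) by (rule l2sq_ift)
    also have "\<dots> \<le> l2sq G" using P(3) by (intro l2sq_mono) simp
    finally show "l2sq (U j l) \<le> ennreal (b\<^sup>2)" using Gb by (rule order_trans)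
  qed
  note [measurable] = L2_measurable[OF U]
  define S where "S n x = (\<Sum>j\<le>n. ennreal (real (n choose j)) * ennreal (cmod (U j (n - j) x)))" for n x
  have [measurable]: "S n \<in> borel_measurable lebesgue" for n
    unfolding S_def by measurable
  define H where "H x = (\<Sum>n. ennreal (K ^ n / fact n) * S n x)" for x
  show ?thesis
  proof (rule that[of H])
    show "H \<in> borel_measurable lebesgue" unfolding H_def by measurable
    have S_le: "(\<integral>\<^sup>+x\<in>ball x0 R. S n x \<partial>lebesgue) \<le> ennreal (2 ^ n * ((2 * R + 1) * b))" for n
    proof -
      have "(\<integral>\<^sup>+x\<in>ball x0 R. S n x \<partial>lebesgue) =
          (\<Sum>j\<le>n. ennreal (real (n choose j)) * (\<integral>\<^sup>+x\<in>ball x0 R. ennreal (cmod (U j (n - j) x)) \<partial>lebesgue))"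
        unfolding S_def sum_distrib_right
        by (subst nn_integral_sum) (auto simp: mult.assoc nn_integral_cmult)
      also have "\<dots> \<le> (\<Sum>j\<le>n. ennreal (real (n choose j)) * ennreal ((2 * R + 1) * b))"
        by (intro sum_mono mult_left_mono nn_integral_ball_le U U_le b R) simp
      also have "\<dots> = ennreal ((\<Sum>j\<le>n. real (n choose j)) * ((2 * R + 1) * b))"
        using R b by (simp add: sum_distrib_right ennreal_mult flip: sum_ennreal)
      also have "(\<Sum>j\<le>n. real (n choose j)) = 2 ^ n"
        using choose_row_sum[of n] by (metis of_nat_numeral of_nat_power of_nat_sum)
      finally show ?thesis .
    qed
    have "(\<integral>\<^sup>+x\<in>ball x0 R. H x \<partial>lebesgue) = (\<Sum>n. ennreal (K ^ n / fact n) * (\<integral>\<^sup>+x\<in>ball x0 R. S n x \<partial>lebesgue))"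
      unfolding H_def ennreal_suminf_multc[symmetric]
      by (subst nn_integral_suminf) (auto simp: mult.assoc nn_integral_cmult)
    also have "\<dots> \<le> (\<Sum>n. ennreal (K ^ n / fact n) * ennreal (2 ^ n * ((2 * R + 1) * b)))"
      by (intro suminf_le summableI mult_left_mono S_le) simp
    also have "\<dots> = (\<Sum>n. ennreal ((2 * K) ^ n / fact n * ((2 * R + 1) * b)))"
      using K R b by (simp add: power_mult_distrib mult_ac flip: ennreal_mult)
    also have "\<dots> = ennreal (exp (2 * K) * ((2 * R + 1) * b))"
    proof (rule suminf_ennreal_eq)
      show "(\<lambda>n. (2 * K) ^ n / fact n * ((2 * R + 1) * b)) sums (exp (2 * K) * ((2 * R + 1) * b))"
        using exp_converges[of "2 * K"] by (intro sums_mult2) (simp add: scaleR_conv_of_real divide_inverse mult.commute)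
    qed (use K R b in simp)
    finally show "(\<integral>\<^sup>+x\<in>ball x0 R. H x \<partial>lebesgue) \<le> ennreal (exp (2 * K) * ((2 * R + 1) * b))" .
  next
    fix x A :: real and w :: complex and \<tau> :: real
    assume A: "\<bar>A\<bar> \<le> K * \<tau>" and w: "cmod w \<le> K * \<tau>" and \<tau>: "0 \<le> \<tau>" "\<tau> \<le> 1"
    define z where "z \<xi> = \<i> * of_real A * m1 \<xi> + w * m2 \<xi>" for \<xi>
    have [measurable]: "z \<in> borel_measurable lebesgue" unfolding z_def by measurable
    define F where "F n \<xi> = (z \<xi> ^ n / fact n) * G \<xi>" for n \<xi>
    have K\<tau>: "K * \<tau> \<le> K" using K \<tau> by (simp add: mult_left_le)
    have z_le: "cmod (z \<xi>) \<le> 2 * K" if "\<bar>\<xi>\<bar> \<le> L" for \<xi>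
    proof -
      have "cmod (z \<xi>) \<le> \<bar>A\<bar> * cmod (m1 \<xi>) + cmod w * cmod (m2 \<xi>)"
        unfolding z_def by (rule norm_triangle_le) (simp add: norm_mult)
      also have "\<dots> \<le> K * 1 + K * 1"
        using m1_le[OF that] m2_le[OF that] A w K\<tau> K by (intro add_mono mult_mono) auto
      finally show ?thesis by simp
    qed
    have F_mult: "cmod (z \<xi> ^ n / fact n) \<le> (2 * K) ^ n / fact n" if "\<bar>\<xi>\<bar> \<le> L" for n \<xi>
    proof -
      have "cmod (z \<xi> ^ n / fact n) = cmod (z \<xi>) ^ n / fact n" by (simp add: norm_divide norm_power)
      also have "\<dots> \<le> (2 * K) ^ n / fact n" by (intro divide_right_mono power_mono z_le that) auto
      finally show ?thesis .
    qed
    have F: "F n \<in> L2" "trunc L (F n) = F n" "cmod (F n \<xi>) \<le> (2 * K) ^ n / fact n * cmod (G \<xi>)" for n \<xi>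
      unfolding F_def[abs_def] by (rule supported_mult[OF G supp _ F_mult]; measurable)+
    have F_int: "integrable lebesgue (F n)" for n using F(1,2) by (rule supported_integrable)
    have e_summ: "summable (\<lambda>n. (2 * K) ^ n / fact n * c)" for c
      using summable_exp[of "2 * K"] by (intro summable_mult2) (simp add: divide_inverse mult.commute)
    have "summable (\<lambda>n. cmod (F n \<xi>))" for \<xi>
      by (rule summable_comparison_test'[OF e_summ[of "cmod (G \<xi>)"], of 0]) (use F(3) in auto)
    moreover have "summable (\<lambda>n. LINT \<xi>|lebesgue. cmod (F n \<xi>))"
    proof (rule summable_comparison_test'[OF e_summ[of "LINT \<xi>|lebesgue. cmod (G \<xi>)"], of 0])
      fix n
      have "(LINT \<xi>|lebesgue. cmod (F n \<xi>)) \<le> (LINT \<xi>|lebesgue. (2 * K) ^ n / fact n * cmod (G \<xi>))"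
        by (intro integral_mono integrable_norm F_int integrable_mult_right supported_integrable[OF G supp] F(3))
      then show "norm (LINT \<xi>|lebesgue. cmod (F n \<xi>)) \<le> (2 * K) ^ n / fact n * (LINT \<xi>|lebesgue. cmod (G \<xi>))"
        by simp
    qed
    ultimately have summ: "summable (\<lambda>n. cmod (ift (F n) x))" and sums: "(\<lambda>n. ift (F n) x) sums ift (\<lambda>\<xi>. \<Sum>n. F n \<xi>) x"
      using ift_sums[OF F_int] by auto
    have F_exp: "(\<Sum>n. F n \<xi>) = exp (z \<xi>) * G \<xi>" for \<xi>
      using sums_mult2[OF exp_converges[of "z \<xi>"], of "G \<xi>"] unfolding F_def
      by (simp add: sums_iff scaleR_conv_of_real divide_inverse mult.commute)
    have F0: "ift (F 0) x = ift G x" by (simp add: F_def[abs_def])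
    have "(\<lambda>n. ift (F (Suc n)) x) sums (ift (\<lambda>\<xi>. exp (z \<xi>) * G \<xi>) x - ift G x)"
      using sums unfolding F_exp by (subst sums_Suc_iff[of "\<lambda>n. ift (F n) x"]) (simp add: F0)
    moreover have "ift (\<lambda>\<xi>. exp (z \<xi>) * G \<xi>) x - ift G x = ift (\<lambda>\<xi>. (exp (z \<xi>) - 1) * G \<xi>) x"
    proof -
      have "cmod (exp (z \<xi>)) \<le> exp (2 * K)" if "\<bar>\<xi>\<bar> \<le> L" for \<xi>
        using norm_exp[of "z \<xi>"] z_le[OF that] by (meson exp_le_cancel_iff order_trans)
      then have "integrable lebesgue (\<lambda>\<xi>. exp (z \<xi>) * G \<xi>)"
        by (intro supported_integrable[of _ L] supported_mult(1,2)[OF G supp, where B="exp (2 * K)"]) measurable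
      from ift_diff[OF this supported_integrable[OF G supp]] show ?thesis
        by (simp add: left_diff_distrib)
    qed
    ultimately have eq: "ift (\<lambda>\<xi>. (exp (z \<xi>) - 1) * G \<xi>) x = (\<Sum>n. ift (F (Suc n)) x)"
      by (simp add: sums_iff)
    \<comment> \<open>The term of degree \<open>N\<close> is homogeneous in \<open>(A, w)\<close>, so it carries \<open>\<tau> ^ N\<close>, which is at most \<open>\<tau>\<close> for \<open>N \<ge> 1\<close>.\<close>
    have summand_le: "ennreal (cmod (ift (F (Suc n)) x)) \<le> ennreal \<tau> * (ennreal (K ^ Suc n / fact (Suc n)) * S (Suc n) x)" for n
    proof -
      define N where "N = Suc n"
      have "F N \<xi> = 1 / fact N * (\<Sum>j\<le>N. (of_nat (N choose j) * (\<i> * of_real A) ^ j * w ^ (N - j)) * P j (N - j) \<xi>)" for \<xi>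
        unfolding F_def z_def binomial_ring P_def
        by (simp add: sum_distrib_left sum_distrib_right power_mult_distrib mult_ac sum_divide_distrib)
      then have "F N = (\<lambda>\<xi>. 1 / fact N * (\<Sum>j\<le>N. (of_nat (N choose j) * (\<i> * of_real A) ^ j * w ^ (N - j)) * P j (N - j) \<xi>))"
        by (rule ext)
      then have "ift (F N) x = 1 / fact N * ift (\<lambda>\<xi>. \<Sum>j\<le>N. (of_nat (N choose j) * (\<i> * of_real A) ^ j * w ^ (N - j)) * P j (N - j) \<xi>) x"
        by (simp only: ift_cmult)
      also have "ift (\<lambda>\<xi>. \<Sum>j\<le>N. (of_nat (N choose j) * (\<i> * of_real A) ^ j * w ^ (N - j)) * P j (N - j) \<xi>) x =
          (\<Sum>j\<le>N. (of_nat (N choose j) * (\<i> * of_real A) ^ j * w ^ (N - j)) * U j (N - j) x)"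
        by (subst ift_sum) (auto intro!: integrable_mult_right P_int simp: ift_cmult U_def)
      finally have "cmod (ift (F N) x) = 1 / fact N * cmod (\<Sum>j\<le>N. (of_nat (N choose j) * (\<i> * of_real A) ^ j * w ^ (N - j)) * U j (N - j) x)"
        by (simp add: norm_divide)
      also have "\<dots> \<le> 1 / fact N * (\<Sum>j\<le>N. real (N choose j) * (\<tau> * K ^ N) * cmod (U j (N - j) x))"
      proof (intro mult_left_mono sum_norm_le)
        fix j assume "j \<in> {..N}"
        then have j: "j \<le> N" by simp
        have "\<bar>A\<bar> ^ j * cmod w ^ (N - j) \<le> (K * \<tau>) ^ j * (K * \<tau>) ^ (N - j)"
          using A w K \<tau> by (intro mult_mono power_mono) auto
        also have "\<dots> = \<tau> ^ N * K ^ N" using j by (simp flip: power_add) (simp add: power_mult_distrib)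
        also have "\<dots> \<le> \<tau> * K ^ N"
          using \<tau> K unfolding N_def by (intro mult_right_mono) (auto simp: mult_left_le power_le_one)
        finally have "\<bar>A\<bar> ^ j * cmod w ^ (N - j) \<le> \<tau> * K ^ N" .
        then have "real (N choose j) * (\<bar>A\<bar> ^ j * cmod w ^ (N - j)) * cmod (U j (N - j) x) \<le> real (N choose j) * (\<tau> * K ^ N) * cmod (U j (N - j) x)"
          by (intro mult_right_mono mult_left_mono) auto
        then show "cmod (of_nat (N choose j) * (\<i> * of_real A) ^ j * w ^ (N - j) * U j (N - j) x) \<le> real (N choose j) * (\<tau> * K ^ N) * cmod (U j (N - j) x)"
          by (simp add: norm_mult norm_power mult.assoc)
      qed simp
      also have "\<dots> = \<tau> * (K ^ N / fact N * (\<Sum>j\<le>N. real (N choose j) * cmod (U j (N - j) x)))"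
        by (simp add: sum_distrib_left mult_ac)
      finally have "ennreal (cmod (ift (F N) x)) \<le> ennreal (\<tau> * (K ^ N / fact N * (\<Sum>j\<le>N. real (N choose j) * cmod (U j (N - j) x))))"
        by (rule ennreal_leI)
      also have "\<dots> = ennreal \<tau> * (ennreal (K ^ N / fact N) * S N x)"
      proof -
        have "S N x = (\<Sum>j\<le>N. ennreal (real (N choose j) * cmod (U j (N - j) x)))"
          by (simp add: S_def ennreal_mult)
        also have "\<dots> = ennreal (\<Sum>j\<le>N. real (N choose j) * cmod (U j (N - j) x))"
          by (rule sum_ennreal) simp
        finally have S: "S N x = ennreal (\<Sum>j\<le>N. real (N choose j) * cmod (U j (N - j) x))" .
        have "ennreal (\<tau> * (k * c)) = ennreal \<tau> * (ennreal k * ennreal c)" if "k \<ge> 0" "c \<ge> 0" for k c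
          using that \<tau> by (simp add: ennreal_mult)
        then show ?thesis unfolding S using K by (simp only: sum_nonneg divide_nonneg_nonneg zero_le_power fact_ge_zero mult_nonneg_nonneg of_nat_0_le_iff norm_ge_zero)
      qed
      finally show ?thesis by (simp only: N_def)
    qed
    have "ennreal (cmod (ift (\<lambda>\<xi>. (exp (z \<xi>) - 1) * G \<xi>) x)) \<le> (\<Sum>n. ennreal (cmod (ift (F (Suc n)) x)))"
    proof -
      have s: "summable (\<lambda>n. cmod (ift (F (Suc n)) x))"
        using summ summable_Suc_iff[of "\<lambda>n. cmod (ift (F n) x)"] by simp
      show ?thesis unfolding eq using summable_norm[OF s]
        by (subst suminf_ennreal2[OF _ s]) (auto intro: ennreal_leI)
    qed
    also have "\<dots> \<le> (\<Sum>n. ennreal \<tau> * (ennreal (K ^ Suc n / fact (Suc n)) * S (Suc n) x))"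
      by (intro suminf_le summableI summand_le)
    also have "\<dots> = ennreal \<tau> * (\<Sum>n. ennreal (K ^ Suc n / fact (Suc n)) * S (Suc n) x)"
      by (rule ennreal_suminf_cmult)
    also have "\<dots> \<le> ennreal \<tau> * H x"
    proof (rule mult_left_mono)
      have "H x = (\<Sum>n. ennreal (K ^ (n + 1) / fact (n + 1)) * S (n + 1) x) + (\<Sum>n<1. ennreal (K ^ n / fact n) * S n x)"
        unfolding H_def by (rule suminf_offset) (rule summableI)
      then show "(\<Sum>n. ennreal (K ^ Suc n / fact (Suc n)) * S (Suc n) x) \<le> H x"
        by (simp add: le_iff_add)
    qed simp
    finally show "ennreal (cmod (ift (\<lambda>\<xi>. (exp (\<i> * of_real A * of_real (\<xi> / L) + w * of_real ((\<bar>\<xi>\<bar> / L) powr a)) - 1) * G \<xi>) x))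
        \<le> ennreal \<tau> * H x"
      unfolding z_def m1_def m2_def .
  qed
qed

section \<open>Integrable majorants of the maximal function\<close>

text \<open>Only integrability of the maximal function on the interval matters for convergence almost everywhere.
  The upper integral is an infimum over measurable majorants \<open>G\<close> of \<open>F powr p\<close>; any of them with finite integral
  gives an integrable majorant of \<open>F\<close> through \<open>q \<le> 1 + q powr p\<close>, applied to \<open>q = F x / (2 * m)\<close>.
  The factor two leaves room to choose \<open>G\<close> strictly above the infimum.\<close>
lemma Lp_majorant:
  assumes p: "p \<ge> 1" and m: "m > 0" and R: "R > 0"
    and bound: "Lp_norm_on p (ball x0 R) F \<le> ennreal m"
  obtains E where "E \<in> borel_measurable lebesgue" "\<And>x. x \<in> ball x0 R \<Longrightarrow> F x \<le> E x"
    "(\<integral>\<^sup>+x\<in>ball x0 R. E x \<partial>lebesgue) \<le> ennreal (2 * m * (2 * R + 1))"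
proof -
  let ?B = "ball x0 R"
  define I where "I = upper_nn_integral (lebesgue_on ?B) (\<lambda>x. epowr (F x) p)"
  have I: "epowr I (1 / p) \<le> ennreal m" using bound by (simp add: Lp_norm_on_def I_def)
  then have I_fin: "I \<noteq> \<infinity>" by (auto simp: epowr_def top_unique split: if_splits)
  with I have "ennreal (enn2real I powr (1 / p)) \<le> ennreal m" by (simp add: epowr_def)
  then have "enn2real I powr (1 / p) \<le> m" using m by (simp add: ennreal_le_iff)
  then have "(enn2real I powr (1 / p)) powr p \<le> m powr p"
    using p by (intro powr_mono2) auto
  then have "enn2real I \<le> m powr p" using p by (simp add: powr_powr)
  also have "\<dots> < (2 * m) powr p" using m p by (intro powr_less_mono2) auto
  finally have "ennreal (enn2real I) < ennreal ((2 * m) powr p)" by (simp add: ennreal_less_iff)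
  then have "I < ennreal ((2 * m) powr p)" using I_fin by (simp add: less_top)
  then obtain G where Gm: "G \<in> borel_measurable (lebesgue_on ?B)"
      and GF: "\<And>x. x \<in> ?B \<Longrightarrow> epowr (F x) p \<le> G x"
      and G_int: "(\<integral>\<^sup>+x. G x \<partial>lebesgue_on ?B) < ennreal ((2 * m) powr p)"
    unfolding I_def upper_nn_integral_def by (auto simp: INF_less_iff)
  define G' where "G' x = (if x \<in> ?B then G x else 0)" for x
  have [measurable]: "G' \<in> borel_measurable lebesgue"
    using Gm unfolding G'_def by (subst (asm) measurable_restrict_space_iff[where c=0]) auto
  have G'_int: "(\<integral>\<^sup>+x\<in>?B. G' x \<partial>lebesgue) = (\<integral>\<^sup>+x. G x \<partial>lebesgue_on ?B)"
    by (subst nn_integral_restrict_space) (auto simp: G'_def intro!: nn_integral_cong split: split_indicator)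
  define c where "c = (1 / (2 * m)) powr p"
  have c: "c \<ge> 0" by (simp add: c_def)
  have c_mult: "(2 * m) powr p * c = 1"
    using m unfolding c_def by (simp flip: powr_mult)
  define E where "E x = ennreal (2 * m) * (1 + ennreal c * G' x)" for x
  show ?thesis
  proof (rule that[of E])
    show "E \<in> borel_measurable lebesgue" unfolding E_def by measurable
    show "F x \<le> E x" if x: "x \<in> ?B" for x
    proof (cases "F x = \<infinity>")
      case True
      then have "G' x = \<infinity>" using GF[OF x] x by (simp add: epowr_def G'_def top_unique)
      then show ?thesis using m by (simp add: E_def c_def ennreal_mult_top ennreal_mult_eq_top_iff)
    next
      case False
      define q where "q = enn2real (F x) / (2 * m)"
      have q: "q \<ge> 0" using m by (simp add: q_def)
      have Fq: "F x = ennreal (2 * m) * ennreal q"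
        using m False by (simp add: q_def less_top flip: ennreal_mult)
      have "q \<le> 1 + q powr p"
      proof (cases "q \<le> 1")
        case False
        then have "q powr 1 \<le> q powr p" using p by (intro powr_mono) auto
        then show ?thesis using False by simp
      qed (simp add: add_increasing2)
      also have "q powr p = c * enn2real (F x) powr p"
        using m by (simp add: q_def c_def powr_divide)
      finally have "ennreal q \<le> ennreal (1 + c * enn2real (F x) powr p)" by (rule ennreal_leI)
      also have "\<dots> = 1 + ennreal c * epowr (F x) p"
        using False c by (simp add: epowr_def ennreal_mult)
      also have "\<dots> \<le> 1 + ennreal c * G' x"
        using GF[OF x] x by (intro add_left_mono mult_left_mono) (auto simp: G'_def)
      finally show ?thesis unfolding E_def Fq by (intro mult_left_mono) auto
    qed
    have "(\<integral>\<^sup>+x\<in>?B. E x \<partial>lebesgue) = ennreal (2 * m) * ((\<integral>\<^sup>+x. indicator ?B x \<partial>lebesgue) + ennreal c * (\<integral>\<^sup>+x\<in>?B. G' x \<partial>lebesgue))"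
      unfolding E_def by (simp add: nn_integral_cmult nn_integral_add distrib_right mult.assoc del: nn_integral_indicator)
    also have "\<dots> \<le> ennreal (2 * m) * (ennreal (2 * R) + ennreal c * ennreal ((2 * m) powr p))"
      using R G_int unfolding G'_int
      by (intro mult_left_mono add_mono) (auto simp: ball_eq_greaterThanLessThan)
    also have "\<dots> = ennreal (2 * m * (2 * R + 1))"
    proof -
      have "ennreal c * ennreal ((2 * m) powr p) = 1"
        using c c_mult by (simp add: mult.commute flip: ennreal_mult)
      moreover have "ennreal (2 * R) + 1 = ennreal (2 * R + 1)"
        using R by (simp add: ennreal_plus)
      moreover have "ennreal (2 * m) * ennreal (2 * R + 1) = ennreal (2 * m * (2 * R + 1))"
        using m R by (intro ennreal_mult[symmetric]) auto
      ultimately show ?thesis by simp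
    qed
    finally show "(\<integral>\<^sup>+x\<in>?B. E x \<partial>lebesgue) \<le> ennreal (2 * m * (2 * R + 1))" .
  qed
qed

section \<open>Band-limited data along curves\<close>

text \<open>The two time-dependent factors of the operator combined into a single exponential, so that
  one power series expands both oscillation and damping.\<close>
definition propagator :: "real \<Rightarrow> real \<Rightarrow> real \<Rightarrow> real \<Rightarrow> complex" where
  "propagator a \<gamma> t \<xi> = exp (Complex (- (t powr \<gamma>)) t * of_real (\<bar>\<xi>\<bar> powr a))"

lemma propagator_measurable [measurable]: "propagator a \<gamma> t \<in> borel_measurable lebesgue"
  unfolding propagator_def by measurable

lemma norm_propagator: "cmod (propagator a \<gamma> t \<xi>) = exp (- (t powr \<gamma> * \<bar>\<xi>\<bar> powr a))"
  by (simp add: propagator_def)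

lemma norm_propagator_le_1: "cmod (propagator a \<gamma> t \<xi>) \<le> 1"
  by (simp add: norm_propagator)

lemma landau_op_eq_ift: "landau_op a \<gamma> t f y = ift (\<lambda>\<xi>. propagator a \<gamma> t \<xi> * fourier f \<xi>) y"
proof -
  have "fourier f \<xi> * exp (\<i> * of_real y * of_real \<xi>) * exp (\<i> * of_real (t * \<bar>\<xi>\<bar> powr a)) * of_real (exp (- (t powr \<gamma> * \<bar>\<xi>\<bar> powr a)))
      = cis (1 * \<xi> * y) * (propagator a \<gamma> t \<xi> * fourier f \<xi>)" for \<xi>
  proof -
    have "propagator a \<gamma> t \<xi> = exp (\<i> * of_real (t * \<bar>\<xi>\<bar> powr a)) * of_real (exp (- (t powr \<gamma> * \<bar>\<xi>\<bar> powr a)))"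
      unfolding propagator_def exp_of_real[symmetric] exp_add[symmetric]
      by (rule arg_cong[of _ _ exp]) (simp add: complex_eq_iff)
    then show ?thesis by (simp add: cis_conv_exp mult_ac)
  qed
  then show ?thesis by (simp only: landau_op_def ift_def osc_def of_real_divide of_real_1 of_real_mult of_real_numeral)
qed

lemma landau_op_ift:
  assumes G: "G \<in> L2" and supp: "trunc L G = G"
  shows "landau_op a \<gamma> t (ift G) y = ift (\<lambda>\<xi>. propagator a \<gamma> t \<xi> * G \<xi>) y"
proof -
  have "fourier (ift G) \<in> L2"
    using fourier_osc_lim[OF ift_L2[OF G supp]] by (simp add: osc_lim_def)
  note [measurable] = L2_measurable[OF this] L2_measurable[OF G]
  show ?thesis
    unfolding landau_op_eq_ift
    by (rule ift_cong_AE) (use fourier_ift[OF G supp] in \<open>auto\<close>)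
qed

lemma ift_sobolev:
  assumes G: "G \<in> L2" and supp: "trunc L G = G" and b: "b > 0"
    and Gb: "(\<integral>\<^sup>+\<xi>. ennreal ((1 + \<bar>\<xi>\<bar>\<^sup>2) powr s * (cmod (G \<xi>))\<^sup>2) \<partial>lebesgue) \<le> ennreal (b\<^sup>2)"
  shows "ift G \<in> sobolev s" "sobolev_norm s (ift G) \<le> b"
proof -
  have uL: "ift G \<in> L2" using G supp by (rule ift_L2)
  have "fourier (ift G) \<in> L2"
    using fourier_osc_lim[OF uL] by (simp add: osc_lim_def)
  note [measurable] = L2_measurable[OF this] L2_measurable[OF G]
  let ?f = "\<lambda>\<xi>. (1 + \<bar>\<xi>\<bar>\<^sup>2) powr s * (cmod (fourier (ift G) \<xi>))\<^sup>2"
  have "(\<integral>\<^sup>+\<xi>. ennreal (?f \<xi>) \<partial>lebesgue) = (\<integral>\<^sup>+\<xi>. ennreal ((1 + \<bar>\<xi>\<bar>\<^sup>2) powr s * (cmod (G \<xi>))\<^sup>2) \<partial>lebesgue)"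
    by (rule nn_integral_cong_AE) (use fourier_ift[OF G supp] in \<open>auto\<close>)
  then have le: "(\<integral>\<^sup>+\<xi>. ennreal (?f \<xi>) \<partial>lebesgue) \<le> ennreal (b\<^sup>2)" using Gb by simp
  then have int: "integrable lebesgue ?f"
    by (intro integrableI_bounded) (auto intro: le_less_trans)
  with uL show "ift G \<in> sobolev s" by (simp add: sobolev_def)
  have "ennreal (LINT \<xi>|lebesgue. ?f \<xi>) \<le> ennreal (b\<^sup>2)"
    using le nn_integral_eq_integral[OF int] by simp
  then have "(LINT \<xi>|lebesgue. ?f \<xi>) \<le> b\<^sup>2" by (simp add: ennreal_le_iff)
  then show "sobolev_norm s (ift G) \<le> b"
    unfolding sobolev_norm_def using b by (intro real_le_lsqrt) (auto intro: integral_nonneg)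
qed

text \<open>The key estimate for frequencies at most \<open>L\<close>.  The natural time unit is \<open>L powr (-\<kappa>)\<close>; put
  \<open>q = t * L powr \<kappa>\<close>.

  If \<open>q \<le> 1\<close>, the two conditions on \<open>\<kappa>\<close> and \<open>L \<ge> 1\<close> give \<open>t powr \<beta> * L \<le> q powr \<beta>\<close>,
  \<open>t * L powr a \<le> q\<close> and \<open>t powr \<gamma> * L powr a \<le> q powr \<gamma>\<close>.  Thus displacement of the curve, phase and
  damping all move the exponent by at most a multiple of \<open>\<tau> = q powr \<mu>\<close>, and the Taylor majorant applies.

  If \<open>q > 1\<close>, no smallness is claimed and the assumed maximal estimate is sufficient.\<close>
lemma band_limited_majorant:
  fixes \<gamma> a p x0 R \<beta> C C1 s :: real and \<Gamma> :: "real \<Rightarrow> real \<Rightarrow> real"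
  assumes \<gamma>: "\<gamma> > 0" and a: "a > 0" and p: "p \<ge> 1" and R: "R > 0" and \<beta>: "0 < \<beta>" "\<beta> \<le> 1"
    and \<Gamma>0: "\<And>x. x \<in> ball x0 R \<Longrightarrow> \<Gamma> x 0 = x"
    and \<Gamma>H: "\<And>x t t'. x \<in> ball x0 R \<Longrightarrow> t \<in> {0..1} \<Longrightarrow> t' \<in> {0..1} \<Longrightarrow>
           \<bar>\<Gamma> x t - \<Gamma> x t'\<bar> \<le> C * \<bar>t - t'\<bar> powr \<beta>"
    and s: "s \<ge> 0" and C1: "C1 > 0"
    and max: "\<And>f. f \<in> sobolev s \<Longrightarrow>
           Lp_norm_on p (ball x0 R) (maximal_fun a \<gamma> \<Gamma> f) \<le> ennreal (C1 * sobolev_norm s f)"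
    and \<kappa>: "\<kappa> * min 1 \<gamma> \<ge> a" "\<kappa> * \<beta> \<ge> 1" and \<mu>: "\<mu> = min \<beta> \<gamma>"
    and G: "G \<in> L2" "trunc L G = G" and L: "L \<ge> 1" and b: "b > 0"
    and Gb: "(\<integral>\<^sup>+\<xi>. ennreal ((1 + \<bar>\<xi>\<bar>\<^sup>2) powr s * (cmod (G \<xi>))\<^sup>2) \<partial>lebesgue) \<le> ennreal (b\<^sup>2)"
  obtains E where "E \<in> borel_measurable lebesgue"
    "(\<integral>\<^sup>+x\<in>ball x0 R. E x \<partial>lebesgue) \<le> ennreal ((2 * C1 + 1 + exp (2 * (\<bar>C\<bar> + 2))) * (2 * R + 1) * b)"
    "\<And>x. x \<in> ball x0 R \<Longrightarrow> ennreal (cmod (ift G x)) \<le> E x"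
    "\<And>x t. x \<in> ball x0 R \<Longrightarrow> 0 < t \<Longrightarrow> t < 1 \<Longrightarrow>
      ennreal (cmod (ift (\<lambda>\<xi>. propagator a \<gamma> t \<xi> * G \<xi>) (\<Gamma> x t) - ift G x))
        \<le> ennreal (min 1 ((t * L powr \<kappa>) powr \<mu>)) * E x"
proof -
  let ?B = "ball x0 R"
  note [measurable] = L2_measurable[OF G(1)]
  have l2sq_G: "l2sq G \<le> ennreal (b\<^sup>2)"
  proof -
    have "1 \<le> (1 + \<bar>\<xi>\<bar>\<^sup>2) powr s" for \<xi> :: real
      using s by (intro ge_one_powr_ge_zero) auto
    then have "l2sq G \<le> (\<integral>\<^sup>+\<xi>. ennreal ((1 + \<bar>\<xi>\<bar>\<^sup>2) powr s * (cmod (G \<xi>))\<^sup>2) \<partial>lebesgue)"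
      unfolding l2sq_def by (intro nn_integral_mono ennreal_leI) (simp add: mult_le_cancel_right1)
    then show ?thesis using Gb by (rule order_trans)
  qed
  have ift_le: "l2sq (ift G) \<le> ennreal (b\<^sup>2)"
    using l2sq_ift[OF G] l2sq_G by (rule order_trans)
  have Lp: "Lp_norm_on p ?B (maximal_fun a \<gamma> \<Gamma> (ift G)) \<le> ennreal (C1 * b)"
    using max[OF ift_sobolev(1)[OF G b Gb]] ift_sobolev(2)[OF G b Gb] C1
    by (elim order_trans) (intro ennreal_leI mult_left_mono, auto)
  obtain E1 where [measurable]: "E1 \<in> borel_measurable lebesgue"
      and E1: "\<And>x. x \<in> ?B \<Longrightarrow> maximal_fun a \<gamma> \<Gamma> (ift G) x \<le> E1 x"
      and E1_int: "(\<integral>\<^sup>+x\<in>?B. E1 x \<partial>lebesgue) \<le> ennreal (2 * (C1 * b) * (2 * R + 1))"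
    by (rule Lp_majorant[OF p mult_pos_pos[OF C1 b] R Lp]) blast
  \<comment> \<open>The Hoelder constant bounds the displacement; the summand 2 counts phase and damping.\<close>
  define K where "K = \<bar>C\<bar> + 2"
  have K: "K \<ge> 0" by (simp add: K_def)
  have L0: "L > 0" using L by simp
  obtain H where [measurable]: "H \<in> borel_measurable lebesgue"
    and H_int: "(\<integral>\<^sup>+x\<in>?B. H x \<partial>lebesgue) \<le> ennreal (exp (2 * K) * ((2 * R + 1) * b))"
    and H: "\<And>x A w \<tau>. \<lbrakk>\<bar>A\<bar> \<le> K * \<tau>; cmod w \<le> K * \<tau>; 0 \<le> \<tau>; \<tau> \<le> 1\<rbrakk> \<Longrightarrow>
      ennreal (cmod (ift (\<lambda>\<xi>. (exp (\<i> * of_real A * of_real (\<xi> / L) + w * of_real ((\<bar>\<xi>\<bar> / L) powr a)) - 1) * G \<xi>) x))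
        \<le> ennreal \<tau> * H x"
    using taylor_majorant[OF G L0 _ K b l2sq_G R, of a x0] a by auto
  define E where "E x = E1 x + ennreal (cmod (ift G x)) + H x" for x
  have ift_E: "ennreal (cmod (ift G x)) \<le> E x" for x
    unfolding E_def by (intro add_increasing2 add_increasing) auto
  show ?thesis
  proof (rule that[of E])
    show "E \<in> borel_measurable lebesgue" unfolding E_def by measurable
    have "(\<integral>\<^sup>+x\<in>?B. E x \<partial>lebesgue) = (\<integral>\<^sup>+x\<in>?B. E1 x \<partial>lebesgue) + (\<integral>\<^sup>+x\<in>?B. ennreal (cmod (ift G x)) \<partial>lebesgue) + (\<integral>\<^sup>+x\<in>?B. H x \<partial>lebesgue)"
      unfolding E_def distrib_right by (simp add: nn_integral_add)
    also have "\<dots> \<le> ennreal (2 * (C1 * b) * (2 * R + 1)) + ennreal ((2 * R + 1) * b) + ennreal (exp (2 * K) * ((2 * R + 1) * b))"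
      by (intro add_mono E1_int H_int nn_integral_ball_le ift_L2[OF G] b ift_le R)
    also have "\<dots> = ennreal ((2 * C1 + 1 + exp (2 * (\<bar>C\<bar> + 2))) * (2 * R + 1) * b)"
      unfolding K_def using C1 R b by (simp add: algebra_simps flip: ennreal_plus)
    finally show "(\<integral>\<^sup>+x\<in>?B. E x \<partial>lebesgue) \<le> ennreal ((2 * C1 + 1 + exp (2 * (\<bar>C\<bar> + 2))) * (2 * R + 1) * b)" .
    show "ennreal (cmod (ift G x)) \<le> E x" for x by (rule ift_E)
    fix x t :: real assume x: "x \<in> ?B" and t: "0 < t" "t < 1"
    define q where "q = t * L powr \<kappa>"
    have q0: "q > 0" using t L by (simp add: q_def)
    let ?D = "cmod (ift (\<lambda>\<xi>. propagator a \<gamma> t \<xi> * G \<xi>) (\<Gamma> x t) - ift G x)"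
    show "ennreal ?D \<le> ennreal (min 1 ((t * L powr \<kappa>) powr \<mu>)) * E x"
    proof (cases "q \<le> 1")
      case False
      have "ennreal (cmod (ift (\<lambda>\<xi>. propagator a \<gamma> t \<xi> * G \<xi>) (\<Gamma> x t))) \<le> maximal_fun a \<gamma> \<Gamma> (ift G) x"
        unfolding maximal_fun_def landau_op_ift[OF G, symmetric] using t by (intro SUP_upper) auto
      also have "\<dots> \<le> E1 x" by (rule E1[OF x])
      finally have "ennreal (cmod (ift (\<lambda>\<xi>. propagator a \<gamma> t \<xi> * G \<xi>) (\<Gamma> x t)) + cmod (ift G x)) \<le> E1 x + ennreal (cmod (ift G x))"
        by (simp add: add_mono)
      moreover have "ennreal ?D \<le> ennreal (cmod (ift (\<lambda>\<xi>. propagator a \<gamma> t \<xi> * G \<xi>) (\<Gamma> x t)) + cmod (ift G x))"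
        by (intro ennreal_leI norm_triangle_ineq4)
      ultimately have "ennreal ?D \<le> E x"
        unfolding E_def by (meson le_iff_add order_trans)
      moreover have "1 \<le> q powr \<mu>"
        using False \<beta> \<gamma> \<mu> by (intro ge_one_powr_ge_zero) auto
      ultimately show ?thesis by (simp add: q_def min_absorb1)
    next
      case True
      define \<tau> where "\<tau> = q powr \<mu>"
      have \<mu>0: "\<mu> > 0" using \<mu> \<beta> \<gamma> by simp
      have \<tau>: "0 \<le> \<tau>" "\<tau> \<le> 1" using q0 True \<mu>0 by (auto simp: \<tau>_def intro: powr_le1)
      \<comment> \<open>Instances: \<open>(e, d)\<close> equal to \<open>(\<beta>, 1)\<close>, \<open>(\<gamma>, a)\<close> and \<open>(1, a)\<close>.\<close>
      have pow: "t powr e * L powr d \<le> \<tau>" if "\<mu> \<le> e" "d \<le> \<kappa> * e" for e d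
      proof -
        have "t powr e * L powr d \<le> t powr e * L powr (\<kappa> * e)"
          using L that by (intro mult_left_mono powr_mono) auto
        also have "\<dots> = q powr e" using t L by (simp add: q_def powr_mult powr_powr)
        also have "\<dots> \<le> \<tau>" unfolding \<tau>_def using q0 True that by (intro powr_mono') auto
        finally show ?thesis .
      qed
      define A where "A = (\<Gamma> x t - x) * L"
      define w where "w = Complex (- (t powr \<gamma>)) t * of_real (L powr a)"
      have "\<bar>A\<bar> \<le> K * \<tau>"
      proof -
        have "\<bar>\<Gamma> x t - x\<bar> \<le> C * t powr \<beta>"
          using \<Gamma>H[OF x, of t 0] \<Gamma>0[OF x] t by simp
        then have "\<bar>A\<bar> \<le> C * t powr \<beta> * L"
          unfolding A_def using L by (simp add: abs_mult mult_right_mono)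
        also have "\<dots> \<le> \<bar>C\<bar> * (t powr \<beta> * L powr 1)"
          using L by (auto simp: mult.assoc intro!: mult_right_mono)
        also have "\<dots> \<le> \<bar>C\<bar> * \<tau>"
          using \<kappa> \<mu> by (intro mult_left_mono pow) auto
        also have "\<dots> \<le> K * \<tau>" using \<tau> by (intro mult_right_mono) (auto simp: K_def)
        finally show ?thesis .
      qed
      moreover have "cmod w \<le> K * \<tau>"
      proof -
        have \<kappa>0: "\<kappa> > 0"
        proof (rule ccontr)
          assume "\<not> \<kappa> > 0"
          then have "\<kappa> * \<beta> \<le> 0" using \<beta> by (intro mult_nonpos_nonneg) auto
          with \<kappa>(2) show False by simp
        qed
        have \<kappa>1: "\<kappa> * min 1 \<gamma> \<le> \<kappa>" "\<kappa> * min 1 \<gamma> \<le> \<kappa> * \<gamma>" using \<kappa>0 by (auto simp: min_def mult_left_le)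
        have "cmod w \<le> (t powr \<gamma> + t) * L powr a"
          unfolding w_def norm_mult using cmod_le[of "Complex (- (t powr \<gamma>)) t"] t
          by (auto intro!: mult_right_mono)
        also have "\<dots> = t powr \<gamma> * L powr a + t powr 1 * L powr a"
          using t by (simp add: distrib_right)
        also have "\<dots> \<le> \<tau> + \<tau>"
          using \<kappa> \<kappa>1 \<mu> \<beta> by (intro add_mono pow) auto
        also have "\<dots> \<le> K * \<tau>" using \<tau> by (auto simp: K_def algebra_simps)
        finally show ?thesis .
      qed
      ultimately have "ennreal (cmod (ift (\<lambda>\<xi>. (exp (\<i> * of_real A * of_real (\<xi> / L) + w * of_real ((\<bar>\<xi>\<bar> / L) powr a)) - 1) * G \<xi>) x)) \<le> ennreal \<tau> * H x"
        using \<tau> by (rule H)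
      also have "(\<lambda>\<xi>. (exp (\<i> * of_real A * of_real (\<xi> / L) + w * of_real ((\<bar>\<xi>\<bar> / L) powr a)) - 1) * G \<xi>) =
          (\<lambda>\<xi>. cis ((\<Gamma> x t - x) * \<xi>) * (propagator a \<gamma> t \<xi> * G \<xi>) - G \<xi>)"
      proof (rule ext)
        fix \<xi>
        have "exp (\<i> * of_real A * of_real (\<xi> / L) + w * of_real ((\<bar>\<xi>\<bar> / L) powr a)) =
            cis ((\<Gamma> x t - x) * \<xi>) * propagator a \<gamma> t \<xi>"
        proof -
          have "w * of_real ((\<bar>\<xi>\<bar> / L) powr a) = Complex (- (t powr \<gamma>)) t * of_real (\<bar>\<xi>\<bar> powr a)"
            using L unfolding w_def mult.assoc of_real_mult[symmetric] by (simp add: powr_divide)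
          moreover have "\<i> * of_real A * of_real (\<xi> / L) = \<i> * of_real ((\<Gamma> x t - x) * \<xi>)"
            using L by (simp add: A_def)
          ultimately show ?thesis
            unfolding propagator_def cis_conv_exp exp_add by (simp only:)
        qed
        then show "(exp (\<i> * of_real A * of_real (\<xi> / L) + w * of_real ((\<bar>\<xi>\<bar> / L) powr a)) - 1) * G \<xi> =
            cis ((\<Gamma> x t - x) * \<xi>) * (propagator a \<gamma> t \<xi> * G \<xi>) - G \<xi>"
          by (simp only: left_diff_distrib mult.assoc mult_1)
      qed
      also have "ift \<dots> x = ift (\<lambda>\<xi>. propagator a \<gamma> t \<xi> * G \<xi>) (\<Gamma> x t) - ift G x"
      proof -
        have "integrable lebesgue (\<lambda>\<xi>. propagator a \<gamma> t \<xi> * G \<xi>)"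
          by (intro supported_integrable[of _ L] supported_mult(1,2)[OF G, where B=1] norm_propagator_le_1) measurable
        from osc_integrand_integrable[OF this, of 1 "\<Gamma> x t - x"]
        have "integrable lebesgue (\<lambda>\<xi>. cis ((\<Gamma> x t - x) * \<xi>) * (propagator a \<gamma> t \<xi> * G \<xi>))"
          by (simp add: mult.commute)
        from ift_diff[OF this supported_integrable[OF G], of x] show ?thesis
          using ift_translate[of "\<lambda>\<xi>. propagator a \<gamma> t \<xi> * G \<xi>" x "\<Gamma> x t - x"] by simp
      qed
      finally have "ennreal ?D \<le> ennreal \<tau> * H x" .
      also have "\<dots> \<le> ennreal \<tau> * E x"
        unfolding E_def by (intro mult_left_mono) (auto simp: le_iff_add add.commute)
      finally show ?thesis using \<tau> by (simp add: \<tau>_def q_def min_absorb2)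
    qed
  qed
qed

section \<open>Dyadic decomposition\<close>

text \<open>The damping factor makes the propagator square integrable, since \<open>exp (-c * \<bar>\<xi>\<bar> powr a)\<close> decays
  faster than \<open>1 / (1 + \<xi>\<^sup>2)\<close>.  Hence the operator is given by an absolutely convergent integral for every
  \<open>L\<^sup>2\<close> datum and every positive time.\<close>
lemma propagator_L2:
  assumes a: "a > 0" and t: "t > 0"
  shows "propagator a \<gamma> t \<in> L2"
proof -
  define c where "c = 2 * t powr \<gamma>"
  have c: "c > 0" using t by (simp add: c_def)
  \<comment> \<open>With this \<open>m\<close>, the term of order \<open>m\<close> of the exponential series dominates a multiple of \<open>\<xi>\<^sup>2\<close> once \<open>\<bar>\<xi>\<bar> > 1\<close>.\<close>
  obtain m :: nat where m: "2 / a \<le> real m" using real_arch_simple by blast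
  define K where "K = 2 + 2 * fact m / c ^ m"
  have K: "K \<ge> 2" using c by (simp add: K_def)
  have le: "(cmod (propagator a \<gamma> t \<xi>))\<^sup>2 \<le> K * inverse (1 + \<xi>\<^sup>2)" for \<xi>
  proof -
    have sq: "(cmod (propagator a \<gamma> t \<xi>))\<^sup>2 = exp (- (c * \<bar>\<xi>\<bar> powr a))"
      by (simp add: norm_propagator c_def mult.assoc flip: exp_double)
    have pos: "1 + \<xi>\<^sup>2 > 0" by (simp add: add_pos_nonneg)
    show ?thesis
    proof (cases "\<bar>\<xi>\<bar> \<le> 1")
      case True
      have "exp (- (c * \<bar>\<xi>\<bar> powr a)) \<le> 1" using c by simp
      also have "1 \<le> K * inverse (1 + \<xi>\<^sup>2)"
        using True K pos abs_square_le_1[of \<xi>] by (simp add: field_simps)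
      finally show ?thesis by (simp only: sq)
    next
      case False
      have "\<xi>\<^sup>2 = \<bar>\<xi>\<bar> powr 2" by simp
      also have "\<dots> \<le> \<bar>\<xi>\<bar> powr (a * real m)"
        using False m a by (intro powr_mono) (auto simp: field_simps)
      also have "\<dots> = (\<bar>\<xi>\<bar> powr a) ^ m"
        using False by (simp add: powr_powr[symmetric] powr_realpow)
      finally have "c ^ m * \<xi>\<^sup>2 \<le> (c * \<bar>\<xi>\<bar> powr a) ^ m"
        using c by (simp add: power_mult_distrib)
      also have "\<dots> \<le> fact m * exp (c * \<bar>\<xi>\<bar> powr a)"
      proof -
        let ?y = "c * \<bar>\<xi>\<bar> powr a"
        have "?y ^ m /\<^sub>R fact m \<le> (\<Sum>n. ?y ^ n /\<^sub>R fact n)"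
          using c summable_exp_generic[of ?y]
          by (intro order_trans[OF _ sum_le_suminf[of _ "{m}"]]) auto
        then show ?thesis by (simp add: exp_def field_simps)
      qed
      finally have "exp (- (c * \<bar>\<xi>\<bar> powr a)) * \<xi>\<^sup>2 \<le> fact m / c ^ m"
        using c by (simp add: exp_minus field_simps)
      moreover have "1 + \<xi>\<^sup>2 \<le> 2 * \<xi>\<^sup>2"
        using False abs_square_le_1[of \<xi>] by simp
      then have "exp (- (c * \<bar>\<xi>\<bar> powr a)) * (1 + \<xi>\<^sup>2) \<le> exp (- (c * \<bar>\<xi>\<bar> powr a)) * (2 * \<xi>\<^sup>2)"
        by (intro mult_left_mono) auto
      ultimately have "exp (- (c * \<bar>\<xi>\<bar> powr a)) * (1 + \<xi>\<^sup>2) \<le> K"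
        unfolding K_def by linarith
      then show ?thesis using pos by (simp add: sq field_simps)
    qed
  qed
  have "integrable lborel (\<lambda>\<xi>::real. inverse (1 + \<xi>\<^sup>2))"
    using integrable_inverse_1_plus_square by (simp add: set_integrable_def)
  then have "integrable lebesgue (\<lambda>\<xi>::real. K * inverse (1 + \<xi>\<^sup>2))"
    by (intro integrable_mult_right) (simp add: integrable_completion)
  then have "integrable lebesgue (\<lambda>\<xi>. (cmod (propagator a \<gamma> t \<xi>))\<^sup>2)"
    by (rule Bochner_Integration.integrable_bound) (use le in \<open>auto intro: order_trans[OF _ abs_ge_self]\<close>)
  then show ?thesis by (simp add: L2_def)
qed

text \<open>The part of \<open>g\<close> with \<open>2 ^ (k - 1) < \<bar>\<xi>\<bar> \<le> 2 ^ k\<close>, and with \<open>\<bar>\<xi>\<bar> \<le> 1\<close> for \<open>k = 0\<close>.\<close>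
definition dyadic_piece :: "(real \<Rightarrow> complex) \<Rightarrow> nat \<Rightarrow> real \<Rightarrow> complex" where
  "dyadic_piece g k \<xi> = (if \<bar>\<xi>\<bar> \<le> 2 ^ k \<and> (k = 0 \<or> 2 ^ k < 2 * \<bar>\<xi>\<bar>) then g \<xi> else 0)"

lemma trunc_dyadic_piece: "trunc (2 ^ k) (dyadic_piece g k) = dyadic_piece g k"
  by (auto simp: trunc_def dyadic_piece_def fun_eq_iff)

lemma sum_dyadic_piece: "(\<Sum>k\<le>n. dyadic_piece g k \<xi>) = trunc (2 ^ n) g \<xi>"
proof (induction n)
  case (Suc n)
  have "(2::real) ^ n \<le> 2 * 2 ^ n" by simp
  with Suc show ?case by (auto simp: trunc_def dyadic_piece_def)
qed (simp add: trunc_def dyadic_piece_def)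

lemma dyadic_piece_L2: "g \<in> L2 \<Longrightarrow> dyadic_piece g k \<in> L2"
proof -
  assume g: "g \<in> L2"
  have "dyadic_piece g k = (\<lambda>\<xi>. (if \<bar>\<xi>\<bar> \<le> 2 ^ k \<and> (k = 0 \<or> 2 ^ k < 2 * \<bar>\<xi>\<bar>) then 1 else 0) * g \<xi>)"
    by (auto simp: dyadic_piece_def fun_eq_iff)
  also have "\<dots> \<in> L2" by (intro L2_bounded_mult g; measurable; simp)
  finally show ?thesis .
qed

text \<open>Lowering the Sobolev exponent by \<open>e\<close> gains a power \<open>e\<close> of the frequency \<open>2 ^ k\<close>.  The division by two
  covers both the lower end of the band and the piece \<open>k = 0\<close>.\<close>
lemma dyadic_piece_weight:
  assumes e: "e \<ge> 0"
  shows "(1 + \<bar>\<xi>\<bar>\<^sup>2) powr (\<sigma> - e) * (cmod (dyadic_piece g k \<xi>))\<^sup>2 \<le>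
    ((2 ^ k / 2) powr (- e))\<^sup>2 * ((1 + \<bar>\<xi>\<bar>\<^sup>2) powr \<sigma> * (cmod (g \<xi>))\<^sup>2)"
proof (cases "dyadic_piece g k \<xi> = 0")
  case False
  then have *: "dyadic_piece g k \<xi> = g \<xi>" "k = 0 \<or> 2 ^ k < 2 * \<bar>\<xi>\<bar>"
    by (auto simp: dyadic_piece_def split: if_splits)
  have "(2 ^ k / 2)\<^sup>2 \<le> 1 + \<bar>\<xi>\<bar>\<^sup>2"
  proof (cases "k = 0")
    case False
    then have "(2 ^ k / 2)\<^sup>2 \<le> \<bar>\<xi>\<bar>\<^sup>2" using * by (intro power_mono) auto
    then show ?thesis by simp
  qed (simp add: power2_eq_square add_increasing2)
  then have "(1 + \<bar>\<xi>\<bar>\<^sup>2) powr (- e) \<le> ((2 ^ k / 2)\<^sup>2) powr (- e)"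
    using e by (intro powr_mono2') auto
  also have "\<dots> = ((2 ^ k / 2) powr (- e))\<^sup>2"
    by (subst power2_eq_square, subst powr_mult) (auto simp: power2_eq_square)
  finally have "(1 + \<bar>\<xi>\<bar>\<^sup>2) powr (- e) \<le> ((2 ^ k / 2) powr (- e))\<^sup>2" .
  then have "(1 + \<bar>\<xi>\<bar>\<^sup>2) powr \<sigma> * (1 + \<bar>\<xi>\<bar>\<^sup>2) powr (- e) * (cmod (g \<xi>))\<^sup>2 \<le>
      (1 + \<bar>\<xi>\<bar>\<^sup>2) powr \<sigma> * ((2 ^ k / 2) powr (- e))\<^sup>2 * (cmod (g \<xi>))\<^sup>2"
    by (intro mult_right_mono mult_left_mono) auto
  then show ?thesis unfolding *(1) by (simp add: mult_ac flip: powr_add)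
qed simp

lemma filterlim_two_power: "filterlim (\<lambda>n. 2 ^ n :: real) at_top sequentially"
  by (rule filterlim_at_top_mono[OF filterlim_real_sequentially])
     (simp add: less_imp_le of_nat_less_two_power)

text \<open>Fourier inversion holds in mean square, hence almost everywhere along a subsequence.\<close>
lemma ift_trunc_AE_subseq:
  assumes f: "f \<in> L2"
  obtains r :: "nat \<Rightarrow> nat" where "strict_mono r"
    "AE x in lebesgue. (\<lambda>n. ift (trunc (2 ^ r n) (fourier f)) x) \<longlonglongrightarrow> f x"
proof -
  let ?g = "fourier f"
  have g: "?g \<in> L2" using fourier_osc_lim[OF f] by (simp add: osc_lim_def)
  note [measurable] = L2_measurable[OF f] L2_measurable[OF g]
  define d where "d n x = osc 1 (trunc (2 ^ n) ?g) x - 2 * pi * f x" for n :: nat and x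
  have d: "d n \<in> L2" for n
    unfolding d_def[abs_def] by (intro L2_diff osc_trunc_L2 g L2_cmult f) simp
  have pow: "filterlim (\<lambda>n. 2 ^ n :: real) at_top sequentially"
    by (rule filterlim_two_power)
  have "((\<lambda>N. l2sq (\<lambda>x. osc 1 (trunc N ?g) x - 2 * pi * f x)) \<longlongrightarrow> 0) at_top"
    using fourier_inversion[OF f] by (simp add: osc_lim_def)
  from filterlim_compose[OF this pow] have "(\<lambda>n. l2sq (d n)) \<longlonglongrightarrow> 0"
    by (simp add: d_def[abs_def])
  moreover have int: "integrable lebesgue (\<lambda>x. (cmod (d n x))\<^sup>2)" for n
    using d by (simp add: L2_def)
  have "l2sq (d n) = ennreal (LINT x|lebesgue. norm ((cmod (d n x))\<^sup>2))" for n
    unfolding l2sq_def using nn_integral_eq_integral[OF int] by simp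
  ultimately have "(\<lambda>n. LINT x|lebesgue. norm ((cmod (d n x))\<^sup>2)) \<longlonglongrightarrow> 0"
    by (simp add: tendsto_ennreal_iff[of _ _ 0, simplified])
  then obtain r :: "nat \<Rightarrow> nat" where r: "strict_mono r" "AE x in lebesgue. (\<lambda>n. (cmod (d (r n) x))\<^sup>2) \<longlonglongrightarrow> 0"
    using tendsto_L1_AE_subseq[of lebesgue "\<lambda>n x. (cmod (d n x))\<^sup>2", OF int] by blast
  from r(2) have "AE x in lebesgue. (\<lambda>n. ift (trunc (2 ^ r n) ?g) x) \<longlonglongrightarrow> f x"
  proof eventually_elim
    case (elim x)
    then have "(\<lambda>n. sqrt ((cmod (d (r n) x))\<^sup>2)) \<longlonglongrightarrow> sqrt 0" by (rule tendsto_real_sqrt)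
    then have "(\<lambda>n. d (r n) x) \<longlonglongrightarrow> 0" by (simp add: tendsto_norm_zero_iff)
    then have "(\<lambda>n. of_real (1 / (2 * pi)) * d (r n) x + f x) \<longlonglongrightarrow> of_real (1 / (2 * pi)) * 0 + f x"
      by (intro tendsto_add tendsto_mult tendsto_const)
    then show ?case by (simp add: d_def ift_def field_simps)
  qed
  with r(1) that show ?thesis by blast
qed

lemma ift_propagator_sums:
  assumes g: "g \<in> L2" and a: "a > 0" and t: "t > 0"
  shows "(\<lambda>k. ift (\<lambda>\<xi>. propagator a \<gamma> t \<xi> * dyadic_piece g k \<xi>) y) sums ift (\<lambda>\<xi>. propagator a \<gamma> t \<xi> * g \<xi>) y"
proof -
  note [measurable] = L2_measurable[OF g]
  have w: "(\<lambda>\<xi>. cis (1 * \<xi> * y) * propagator a \<gamma> t \<xi>) \<in> L2"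
    by (intro L2_bounded_mult(1) propagator_L2 a t) auto
  have pow: "filterlim (\<lambda>n. 2 ^ n :: real) at_top sequentially"
    by (rule filterlim_two_power)
  have "(\<lambda>n. LINT \<xi>|lebesgue. trunc (2 ^ n) g \<xi> * (cis (1 * \<xi> * y) * propagator a \<gamma> t \<xi>)) \<longlonglongrightarrow>
      (LINT \<xi>|lebesgue. g \<xi> * (cis (1 * \<xi> * y) * propagator a \<gamma> t \<xi>))"
    by (intro L2_tendsto_integral trunc_L2 g w filterlim_compose[OF trunc_tendsto_L2[OF g] pow])
  then have "(\<lambda>n. 1 / (2 * pi) * (LINT \<xi>|lebesgue. trunc (2 ^ n) g \<xi> * (cis (1 * \<xi> * y) * propagator a \<gamma> t \<xi>))) \<longlonglongrightarrow>
      1 / (2 * pi) * (LINT \<xi>|lebesgue. g \<xi> * (cis (1 * \<xi> * y) * propagator a \<gamma> t \<xi>))"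
    by (intro tendsto_mult tendsto_const)
  then have lim: "(\<lambda>n. ift (\<lambda>\<xi>. propagator a \<gamma> t \<xi> * trunc (2 ^ n) g \<xi>) y) \<longlonglongrightarrow> ift (\<lambda>\<xi>. propagator a \<gamma> t \<xi> * g \<xi>) y"
    by (simp add: ift_def osc_def mult_ac)
  have int: "integrable lebesgue (\<lambda>\<xi>. propagator a \<gamma> t \<xi> * dyadic_piece g k \<xi>)" for k
    by (intro L2_mult_integrable propagator_L2 a t dyadic_piece_L2 g)
  have "(\<Sum>k\<le>n. ift (\<lambda>\<xi>. propagator a \<gamma> t \<xi> * dyadic_piece g k \<xi>) y) = ift (\<lambda>\<xi>. propagator a \<gamma> t \<xi> * trunc (2 ^ n) g \<xi>) y" for n
    by (subst ift_sum[symmetric]) (auto simp: int sum_dyadic_piece simp flip: sum_distrib_left)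
  with lim show ?thesis unfolding sums_def_le by simp
qed

section \<open>The rate of convergence\<close>

text \<open>The hypotheses say that \<open>\<kappa>\<close> is at least \<open>a / min 1 \<gamma>\<close> and at least \<open>1 / \<beta>\<close>; taking the larger
  of the two treats both regimes of \<open>\<beta>\<close> at once.  The trade of smoothness for a rate is \<open>\<kappa> * h \<le> \<delta>\<close>.

  For the dyadic piece \<open>P k\<close>, the band-limited estimate and \<open>min 1 (q powr \<mu>) \<le> q powr h\<close> with
  \<open>q = t * (2 ^ k) powr \<kappa>\<close> bound the difference, divided by \<open>t powr h\<close>, by \<open>(2 ^ k) powr (\<kappa> * h) * E k x\<close>,
  uniformly in \<open>t\<close>.  The integral of this bound decays geometrically in \<open>k\<close> because the maximal estimate
  is applied at a smoothness \<open>s'\<close> strictly between \<open>s0\<close> and \<open>s\<close>; so the series of bounds is finite almost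
  everywhere.  Each single difference is \<open>o(t powr h)\<close> because \<open>h < \<mu>\<close>, and Tannery's theorem
  sums the pieces.\<close>
lemma convergence_rate:
  fixes \<gamma> a p x0 R \<beta> C s0 \<kappa> \<delta> h s :: real and \<Gamma> :: "real \<Rightarrow> real \<Rightarrow> real"
  assumes \<gamma>: "\<gamma> > 0" and a: "a > 0" and p: "p \<ge> 1" and R: "R > 0" and \<beta>: "0 < \<beta>" "\<beta> \<le> 1"
    and \<Gamma>0: "\<And>x. x \<in> ball x0 R \<Longrightarrow> \<Gamma> x 0 = x"
    and \<Gamma>H: "\<And>x t t'. x \<in> ball x0 R \<Longrightarrow> t \<in> {0..1} \<Longrightarrow> t' \<in> {0..1} \<Longrightarrow>
           \<bar>\<Gamma> x t - \<Gamma> x t'\<bar> \<le> C * \<bar>t - t'\<bar> powr \<beta>"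
    and s0: "s0 \<ge> 0"
    and max: "\<And>s. s > s0 \<Longrightarrow> \<exists>Cs::real. \<forall>f\<in>sobolev s.
           Lp_norm_on p (ball x0 R) (maximal_fun a \<gamma> \<Gamma> f) \<le> ennreal (Cs * sobolev_norm s f)"
    and \<kappa>: "\<kappa> * min 1 \<gamma> \<ge> a" "\<kappa> * \<beta> \<ge> 1"
    and h: "0 \<le> h" "h < min \<beta> \<gamma>" and \<delta>: "\<kappa> * h \<le> \<delta>"
    and s: "s > s0" and f: "f \<in> sobolev (s + \<delta>)"
  shows "AE x\<in>ball x0 R in lebesgue.
    (\<lambda>t. landau_op a \<gamma> t f (\<Gamma> x t) - f x) \<in> o[at_right 0](\<lambda>t. of_real (t powr h))"
proof -
  let ?B = "ball x0 R"
  define \<mu> where "\<mu> = min \<beta> \<gamma>"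
  define g where "g = fourier f"
  define P where "P k = dyadic_piece g k" for k
  have \<kappa>0: "\<kappa> > 0"
  proof (rule ccontr)
    assume "\<not> \<kappa> > 0"
    then have "\<kappa> * \<beta> \<le> 0" using \<beta> by (intro mult_nonpos_nonneg) auto
    with \<kappa>(2) show False by simp
  qed
  have fL: "f \<in> L2" using f by (simp add: sobolev_def)
  have gL: "g \<in> L2" using fourier_osc_lim[OF fL] by (simp add: osc_lim_def g_def)
  note [measurable] = L2_measurable[OF gL]
  have P: "P k \<in> L2" "trunc (2 ^ k) (P k) = P k" for k
    using dyadic_piece_L2[OF gL] trunc_dyadic_piece by (auto simp: P_def)
  note [measurable] = L2_measurable[OF P(1)]

  \<comment> \<open>Any exponent strictly between \<open>s0\<close> and \<open>s\<close> would do.\<close>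
  define s' where "s' = (s0 + s) / 2"
  have s': "s' > s0" "s' \<ge> 0" "s' < s" using s s0 by (auto simp: s'_def)
  obtain Cs where Cs: "\<And>f. f \<in> sobolev s' \<Longrightarrow>
      Lp_norm_on p ?B (maximal_fun a \<gamma> \<Gamma> f) \<le> ennreal (Cs * sobolev_norm s' f)"
    using max[OF s'(1)] by blast
  define C1 where "C1 = \<bar>Cs\<bar> + 1"
  have C1: "C1 > 0" by (simp add: C1_def)
  have max': "Lp_norm_on p ?B (maximal_fun a \<gamma> \<Gamma> f) \<le> ennreal (C1 * sobolev_norm s' f)"
    if "f \<in> sobolev s'" for f
  proof -
    have "0 \<le> sobolev_norm s' f" by (simp add: sobolev_norm_def)
    then show ?thesis
      by (intro order_trans[OF Cs[OF that]] ennreal_leI mult_right_mono) (auto simp: C1_def)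
  qed

  define e where "e = s + \<delta> - s'"
  have "0 \<le> \<kappa> * h" using \<kappa>0 h by simp
  then have e: "e > \<kappa> * h" "e > 0" using s' \<delta> by (auto simp: e_def)
  \<comment> \<open>The added 1 keeps the bounds \<open>b k\<close> positive, as \<open>band_limited_majorant\<close> requires.\<close>
  define M where "M = sobolev_norm (s + \<delta>) f + 1"
  have M: "M > 0" unfolding M_def sobolev_norm_def by (simp add: add_nonneg_pos)
  have M_int: "(\<integral>\<^sup>+\<xi>. ennreal ((1 + \<bar>\<xi>\<bar>\<^sup>2) powr (s + \<delta>) * (cmod (g \<xi>))\<^sup>2) \<partial>lebesgue) \<le> ennreal (M\<^sup>2)"
  proof -
    let ?F = "\<lambda>\<xi>. (1 + \<bar>\<xi>\<bar>\<^sup>2) powr (s + \<delta>) * (cmod (g \<xi>))\<^sup>2"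
    have int: "integrable lebesgue ?F" using f by (simp add: sobolev_def g_def)
    have "0 \<le> (LINT \<xi>|lebesgue. ?F \<xi>)" by (intro Bochner_Integration.integral_nonneg) auto
    then have "(LINT \<xi>|lebesgue. ?F \<xi>) = (sobolev_norm (s + \<delta>) f)\<^sup>2"
      by (simp add: sobolev_norm_def g_def)
    also have "\<dots> \<le> M\<^sup>2" unfolding M_def by (intro power_mono) (auto simp: sobolev_norm_def)
    finally show ?thesis using nn_integral_eq_integral[OF int] by (simp add: ennreal_leI)
  qed
  define b where "b k = M * (2 ^ k / 2) powr (- e)" for k :: nat
  have b: "b k > 0" for k using M by (simp add: b_def)
  have Pb: "(\<integral>\<^sup>+\<xi>. ennreal ((1 + \<bar>\<xi>\<bar>\<^sup>2) powr s' * (cmod (P k \<xi>))\<^sup>2) \<partial>lebesgue) \<le> ennreal ((b k)\<^sup>2)" for k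
  proof -
    let ?w = "((2 ^ k / 2) powr (- e))\<^sup>2"
    have "(\<integral>\<^sup>+\<xi>. ennreal ((1 + \<bar>\<xi>\<bar>\<^sup>2) powr s' * (cmod (P k \<xi>))\<^sup>2) \<partial>lebesgue) \<le>
        (\<integral>\<^sup>+\<xi>. ennreal ?w * ennreal ((1 + \<bar>\<xi>\<bar>\<^sup>2) powr (s + \<delta>) * (cmod (g \<xi>))\<^sup>2) \<partial>lebesgue)"
      using dyadic_piece_weight[of e _ "s + \<delta>" g k] e
      by (intro nn_integral_mono) (simp add: e_def P_def ennreal_leI flip: ennreal_mult)
    also have "\<dots> = ennreal ?w * (\<integral>\<^sup>+\<xi>. ennreal ((1 + \<bar>\<xi>\<bar>\<^sup>2) powr (s + \<delta>) * (cmod (g \<xi>))\<^sup>2) \<partial>lebesgue)"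
      by (rule nn_integral_cmult) measurable
    also have "\<dots> \<le> ennreal ?w * ennreal (M\<^sup>2)" by (intro mult_left_mono M_int) simp
    also have "\<dots> = ennreal ((b k)\<^sup>2)"
      by (simp add: b_def power_mult_distrib mult.commute flip: ennreal_mult)
    finally show ?thesis .
  qed
  define K where "K = (2 * C1 + 1 + exp (2 * (\<bar>C\<bar> + 2))) * (2 * R + 1)"
  have K: "K \<ge> 0" using C1 R by (simp add: K_def)
  \<comment> \<open>The properties of a majorant of the \<open>k\<close>-th piece, named so that one is chosen for each \<open>k\<close>.\<close>
  define Q where "Q k E \<longleftrightarrow> E \<in> borel_measurable lebesgue \<and>
    (\<integral>\<^sup>+x\<in>?B. E x \<partial>lebesgue) \<le> ennreal (K * b k) \<and>
    (\<forall>x\<in>?B. ennreal (cmod (ift (P k) x)) \<le> E x) \<and>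
    (\<forall>x\<in>?B. \<forall>t. 0 < t \<longrightarrow> t < 1 \<longrightarrow>
      ennreal (cmod (ift (\<lambda>\<xi>. propagator a \<gamma> t \<xi> * P k \<xi>) (\<Gamma> x t) - ift (P k) x))
        \<le> ennreal (min 1 ((t * (2 ^ k) powr \<kappa>) powr \<mu>)) * E x)" for k E
  have "\<exists>E. Q k E" for k
  proof -
    have two: "1 \<le> (2::real) ^ k" by (rule one_le_power) simp
    obtain E where "E \<in> borel_measurable lebesgue"
      "(\<integral>\<^sup>+x\<in>?B. E x \<partial>lebesgue) \<le> ennreal (K * b k)"
      "\<And>x. x \<in> ?B \<Longrightarrow> ennreal (cmod (ift (P k) x)) \<le> E x"
      "\<And>x t. x \<in> ?B \<Longrightarrow> 0 < t \<Longrightarrow> t < 1 \<Longrightarrow>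
        ennreal (cmod (ift (\<lambda>\<xi>. propagator a \<gamma> t \<xi> * P k \<xi>) (\<Gamma> x t) - ift (P k) x))
          \<le> ennreal (min 1 ((t * (2 ^ k) powr \<kappa>) powr \<mu>)) * E x"
      using \<gamma> a p R \<beta> \<Gamma>0 \<Gamma>H s'(2) C1 max' \<kappa> \<mu>_def P[of k] two b[of k] Pb[of k] that[unfolded K_def]
      by (rule band_limited_majorant)
    then have "Q k E" unfolding Q_def by (intro conjI ballI allI impI)
    then show ?thesis by (rule exI[of _ E])
  qed
  then obtain E where Q: "\<And>k. Q k (E k)" by metis
  have E [measurable]: "E k \<in> borel_measurable lebesgue"
    and E_int: "(\<integral>\<^sup>+x\<in>?B. E k x \<partial>lebesgue) \<le> ennreal (K * b k)"
    and E_ift: "x \<in> ?B \<Longrightarrow> ennreal (cmod (ift (P k) x)) \<le> E k x"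
    and E_diff: "x \<in> ?B \<Longrightarrow> 0 < t \<Longrightarrow> t < 1 \<Longrightarrow>
      ennreal (cmod (ift (\<lambda>\<xi>. propagator a \<gamma> t \<xi> * P k \<xi>) (\<Gamma> x t) - ift (P k) x))
        \<le> ennreal (min 1 ((t * (2 ^ k) powr \<kappa>) powr \<mu>)) * E k x" for k x t
    using Q[of k] unfolding Q_def by simp_all

  \<comment> \<open>The loss in the \<open>k\<close>-th piece that is caused by dividing by \<open>t powr h\<close>.\<close>
  define c where "c k = (2 ^ k) powr (\<kappa> * h)" for k :: nat
  have c: "c k \<ge> 1" for k
    unfolding c_def using \<kappa>0 h by (intro ge_one_powr_ge_zero) auto
  have "(\<integral>\<^sup>+x. (\<Sum>k. ennreal (c k) * E k x) * indicator ?B x \<partial>lebesgue) =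
      (\<Sum>k. ennreal (c k) * (\<integral>\<^sup>+x\<in>?B. E k x \<partial>lebesgue))"
    unfolding ennreal_suminf_multc[symmetric]
    by (subst nn_integral_suminf) (auto simp: mult.assoc nn_integral_cmult)
  also have "\<dots> \<le> (\<Sum>k. ennreal (c k) * ennreal (K * b k))"
    by (intro suminf_le summableI mult_left_mono E_int) simp
  also have "\<dots> = (\<Sum>k. ennreal (K * M * 2 powr e * (2 powr (\<kappa> * h - e)) ^ k))"
  proof (intro suminf_cong)
    fix k
    have eq: "c k * (K * b k) = K * M * 2 powr e * (2 powr (\<kappa> * h - e)) ^ k"
    proof -
      have "(2 powr (\<kappa> * h - e)) ^ k = (2 ^ k) powr (\<kappa> * h - e)"
        by (simp add: powr_powr mult.commute flip: powr_realpow)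
      also have "\<dots> = (2 ^ k) powr (\<kappa> * h) * (2 ^ k) powr (- e)"
        by (simp flip: powr_add)
      finally show ?thesis
        by (simp add: c_def b_def powr_divide powr_minus field_simps)
    qed
    have "ennreal (c k) * ennreal (K * b k) = ennreal (c k * (K * b k))"
      using c[of k] K b[of k] by (intro ennreal_mult[symmetric]) auto
    then show "ennreal (c k) * ennreal (K * b k) = ennreal (K * M * 2 powr e * (2 powr (\<kappa> * h - e)) ^ k)"
      by (simp only: eq)
  qed
  also have "\<dots> < \<infinity>"
  proof -
    have "2 powr (\<kappa> * h - e) < (1::real)" using e by (simp add: powr_less_one)
    then have "summable (\<lambda>k. K * M * 2 powr e * (2 powr (\<kappa> * h - e)) ^ k)"
      by (intro summable_mult summable_geometric) simp
    then show ?thesis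
      using K M by (subst suminf_ennreal2) auto
  qed
  finally have "AE x in lebesgue. (\<Sum>k. ennreal (c k) * E k x) * indicator ?B x \<noteq> \<infinity>"
    by (intro nn_integral_PInf_AE) auto
  moreover obtain r :: "nat \<Rightarrow> nat" where r: "strict_mono r"
    "AE x in lebesgue. (\<lambda>n. ift (trunc (2 ^ r n) g) x) \<longlonglongrightarrow> f x"
    using ift_trunc_AE_subseq[OF fL] unfolding g_def by blast
  ultimately show ?thesis
  proof eventually_elim
    case (elim x)
    have "(\<lambda>t. landau_op a \<gamma> t f (\<Gamma> x t) - f x) \<in> o[at_right 0](\<lambda>t. of_real (t powr h))" if x: "x \<in> ?B"
    proof -
      define \<epsilon> where "\<epsilon> k = enn2real (E k x)" for k
      have fin: "(\<Sum>k. ennreal (c k) * E k x) \<noteq> \<infinity>" using elim(1) x by simp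
      have E_fin: "E k x \<noteq> \<infinity>" for k
      proof
        assume "E k x = \<infinity>"
        moreover have "ennreal (c k) * E k x \<le> (\<Sum>k. ennreal (c k) * E k x)"
          using sum_le_suminf[OF summableI, of "{k}" "\<lambda>k. ennreal (c k) * E k x"] by simp
        ultimately show False using fin c[of k]
          by (auto simp: ennreal_mult_eq_top_iff top_unique)
      qed
      have E_eq: "E k x = ennreal (\<epsilon> k)" and \<epsilon>: "\<epsilon> k \<ge> 0" for k
        using E_fin[of k] by (auto simp: \<epsilon>_def less_top)
      have c0: "c k \<ge> 0" for k by (simp add: c_def)
      have "ennreal (c k) * E k x = ennreal (c k * \<epsilon> k)" for k
        using c0 \<epsilon> by (simp add: E_eq ennreal_mult)
      with fin have "(\<Sum>k. ennreal (c k * \<epsilon> k)) \<noteq> top" by simp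
      then have summ: "summable (\<lambda>k. c k * \<epsilon> k)"
        using c0 \<epsilon> by (intro summable_suminf_not_top) simp_all
      have ift_le: "cmod (ift (P k) x) \<le> \<epsilon> k" for k
        using E_ift[OF x, of k] \<epsilon> by (simp add: E_eq)
      define D where "D k t = ift (\<lambda>\<xi>. propagator a \<gamma> t \<xi> * P k \<xi>) (\<Gamma> x t) - ift (P k) x" for k t
      have D_le: "cmod (D k t) \<le> min 1 ((t * (2 ^ k) powr \<kappa>) powr \<mu>) * \<epsilon> k" if "0 < t" "t < 1" for k t
        using E_diff[OF x that, of k] \<epsilon>[of k] by (simp add: D_def E_eq flip: ennreal_mult)

      have "summable (\<lambda>k. ift (P k) x)"
      proof (rule summable_comparison_test'[OF summ, of 0])
        fix k show "norm (ift (P k) x) \<le> c k * \<epsilon> k"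
          using ift_le[of k] mult_right_mono[OF c[of k] \<epsilon>[of k]] by simp
      qed
      then have "(\<lambda>n. \<Sum>k\<le>n. ift (P k) x) \<longlonglongrightarrow> (\<Sum>k. ift (P k) x)"
        using summable_sums sums_def_le by blast
      moreover have "(\<Sum>k\<le>n. ift (P k) x) = ift (trunc (2 ^ n) g) x" for n
        using supported_integrable[OF P] by (subst ift_sum[symmetric]) (auto simp: P_def sum_dyadic_piece)
      ultimately have "(\<lambda>n. ift (trunc (2 ^ n) g) x) \<longlonglongrightarrow> (\<Sum>k. ift (P k) x)" by simp
      from LIMSEQ_subseq_LIMSEQ[OF this r(1)] elim(2) have "(\<Sum>k. ift (P k) x) = f x"
        by (auto simp: o_def intro: LIMSEQ_unique)
      with \<open>summable (\<lambda>k. ift (P k) x)\<close> have ift_sums_f: "(\<lambda>k. ift (P k) x) sums f x"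
        by (simp add: sums_iff)
      have D_sums: "(\<lambda>k. D k t) sums (landau_op a \<gamma> t f (\<Gamma> x t) - f x)" if "t > 0" for t
        unfolding D_def landau_op_eq_ift P_def g_def[symmetric]
        using ift_propagator_sums[OF gL a that] ift_sums_f[unfolded P_def] by (rule sums_diff)

      have "((\<lambda>t. \<Sum>k. D k t / of_real (t powr h)) \<longlongrightarrow> (\<Sum>k. 0)) (at_right 0)"
      proof (rule tannerys_theorem[THEN conjunct2, THEN conjunct2])
        have ev01: "eventually (\<lambda>t::real. 0 < t \<and> t < 1) (at_right 0)"
          using eventually_at_right_real[of 0 1] by simp
        have D_div: "cmod (D k t / of_real (t powr h)) = cmod (D k t) / t powr h" if "0 < t" for k t
          using that by (simp add: norm_divide)
        show "((\<lambda>t. D k t / of_real (t powr h)) \<longlongrightarrow> 0) (at_right 0)" for k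
        proof (rule Lim_null_comparison)
          show "eventually (\<lambda>t. norm (D k t / of_real (t powr h)) \<le> t powr (\<mu> - h) * (((2 ^ k) powr \<kappa>) powr \<mu> * \<epsilon> k)) (at_right 0)"
            using ev01
          proof eventually_elim
            case (elim t)
            have "cmod (D k t) \<le> (t * (2 ^ k) powr \<kappa>) powr \<mu> * \<epsilon> k"
              using D_le[of t k] elim by (intro order_trans[OF D_le mult_right_mono]) (auto simp: \<epsilon>)
            also have "\<dots> = t powr (\<mu> - h) * (((2 ^ k) powr \<kappa>) powr \<mu> * \<epsilon> k) * t powr h"
              using elim by (simp add: powr_mult powr_diff)
            finally show ?case using elim by (simp add: D_div divide_le_eq)
          qed
          have "((\<lambda>t::real. t powr (\<mu> - h)) \<longlongrightarrow> 0) (at_right 0)"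
            using h by (intro tendsto_zero_powrI[where b="\<mu> - h"]) (auto simp: \<mu>_def intro!: tendsto_intros eventually_at_right_less[THEN eventually_mono])
          then show "((\<lambda>t. t powr (\<mu> - h) * (((2 ^ k) powr \<kappa>) powr \<mu> * \<epsilon> k)) \<longlongrightarrow> 0) (at_right 0)"
            by (rule tendsto_mult_left_zero)
        qed
        have bound: "norm (D k t / of_real (t powr h)) \<le> c k * \<epsilon> k" if t: "0 < t" "t < 1" for k t
        proof -
          define q where "q = t * (2 ^ k) powr \<kappa>"
          have q: "q > 0" using t by (simp add: q_def)
          have "min 1 (q powr \<mu>) \<le> q powr h"
          proof (cases "q \<le> 1")
            case True
            then have "q powr \<mu> \<le> q powr h" using q h by (intro powr_mono') (auto simp: \<mu>_def)
            then show ?thesis by simp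
          next
            case False
            then have "1 \<le> q powr h" using h by (intro ge_one_powr_ge_zero) auto
            then show ?thesis by simp
          qed
          then have "cmod (D k t) \<le> q powr h * \<epsilon> k"
            using D_le[OF t, of k] \<epsilon>[of k] by (auto simp: q_def intro: order_trans[OF _ mult_right_mono])
          also have "q powr h = c k * t powr h"
            using t by (simp add: q_def c_def powr_mult powr_powr)
          finally show ?thesis using t by (simp add: D_div divide_le_eq mult_ac)
        qed
        show "eventually (\<lambda>(k, t). norm (D k t / of_real (t powr h)) \<le> c k * \<epsilon> k) (at_top \<times>\<^sub>F at_right 0)"
          unfolding eventually_prod_filter using bound ev01
          by (intro exI[of _ "\<lambda>_. True"] exI[of _ "\<lambda>t. 0 < t \<and> t < 1"]) auto
      qed (use summ in auto)
      then have lim: "((\<lambda>t. \<Sum>k. D k t / of_real (t powr h)) \<longlongrightarrow> 0) (at_right 0)" by simp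
      have pos: "eventually (\<lambda>t::real. t > 0) (at_right 0)" by (rule eventually_at_right_less)
      have "((\<lambda>t. (landau_op a \<gamma> t f (\<Gamma> x t) - f x) / of_real (t powr h)) \<longlongrightarrow> 0) (at_right 0)"
      proof (rule Lim_transform_eventually[OF lim])
        show "eventually (\<lambda>t. (\<Sum>k. D k t / of_real (t powr h)) = (landau_op a \<gamma> t f (\<Gamma> x t) - f x) / of_real (t powr h)) (at_right 0)"
          using pos by eventually_elim (use sums_divide[OF D_sums] in \<open>simp add: sums_iff\<close>)
      qed
      moreover have "eventually (\<lambda>t. complex_of_real (t powr h) \<noteq> 0) (at_right 0)"
        using pos by eventually_elim simp
      ultimately show ?thesis
        by (rule smalloI_tendsto)
    qed
    with elim show ?case by blast
  qed
qed

theorem theorem1p3: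
  fixes \<gamma> a p x0 R \<beta> C s0 :: real and \<Gamma> :: "real \<Rightarrow> real \<Rightarrow> real"
  assumes "\<gamma> > 0" and "a > 0" and "p \<ge> 1" and "R > 0" and "0 < \<beta>" and "\<beta> \<le> 1"
    and "\<And>x. x \<in> ball x0 R \<Longrightarrow> \<Gamma> x 0 = x"
    and "\<And>x t t'. x \<in> ball x0 R \<Longrightarrow> t \<in> {0..1} \<Longrightarrow> t' \<in> {0..1} \<Longrightarrow>
           \<bar>\<Gamma> x t - \<Gamma> x t'\<bar> \<le> C * \<bar>t - t'\<bar> powr \<beta>"
    and "s0 \<ge> 0"
    and "\<And>s. s > s0 \<Longrightarrow> \<exists>Cs::real. \<forall>f\<in>sobolev s.
           Lp_norm_on p (ball x0 R) (maximal_fun a \<gamma> \<Gamma> f) \<le> ennreal (Cs * sobolev_norm s f)"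
  shows "(a \<ge> min 1 \<gamma> \<and> min 1 \<gamma> / a \<le> \<beta> \<and> \<beta> \<le> 1 \<longrightarrow>
            (\<forall>(\<delta>, h)\<in>D1 a \<gamma> \<beta>. \<forall>s>s0. \<forall>f\<in>sobolev (s + \<delta>).
               AE x\<in>ball x0 R in lebesgue.
                 (\<lambda>t. landau_op a \<gamma> t f (\<Gamma> x t) - f x) \<in> o[at_right 0](\<lambda>t. of_real (t powr h))))
       \<and> ((a \<ge> min 1 \<gamma> \<and> 0 < \<beta> \<and> \<beta> < min 1 \<gamma> / a) \<or> (a < min 1 \<gamma> \<and> 0 < \<beta> \<and> \<beta> \<le> 1) \<longrightarrow>
            (\<forall>(\<delta>, h)\<in>D2 \<gamma> \<beta>. \<forall>s>s0. \<forall>f\<in>sobolev (s + \<delta>).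
               AE x\<in>ball x0 R in lebesgue.
                 (\<lambda>t. landau_op a \<gamma> t f (\<Gamma> x t) - f x) \<in> o[at_right 0](\<lambda>t. of_real (t powr h))))"
proof -
  have rate: "AE x\<in>ball x0 R in lebesgue.
      (\<lambda>t. landau_op a \<gamma> t f (\<Gamma> x t) - f x) \<in> o[at_right 0](\<lambda>t. of_real (t powr h))"
    if "\<kappa> * min 1 \<gamma> \<ge> a" "\<kappa> * \<beta> \<ge> 1" "0 \<le> h" "h < min \<beta> \<gamma>" "\<kappa> * h \<le> \<delta>" "s > s0" "f \<in> sobolev (s + \<delta>)"
    for \<kappa> \<delta> h s f
    using assms that by (rule convergence_rate)
  have \<gamma>1: "min 1 \<gamma> > 0" using assms(1) by simp
  show ?thesis
  proof (intro conjI impI ballI allI)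
    assume *: "a \<ge> min 1 \<gamma> \<and> min 1 \<gamma> / a \<le> \<beta> \<and> \<beta> \<le> 1"
    fix z assume "z \<in> D1 a \<gamma> \<beta>"
    then obtain \<delta> h where z: "z = (\<delta>, h)" and h: "0 \<le> h" "h < min \<beta> \<gamma>" and \<delta>: "h \<le> \<delta> * (min 1 \<gamma> / a)"
      by (auto simp: D1_def)
    have k: "a / min 1 \<gamma> * min 1 \<gamma> \<ge> a" "a / min 1 \<gamma> * \<beta> \<ge> 1" "a / min 1 \<gamma> * h \<le> \<delta>"
      using * \<delta> \<gamma>1 assms(2) by (simp_all add: field_simps)
    show "case z of (\<delta>, h) \<Rightarrow> \<forall>s>s0. \<forall>f\<in>sobolev (s + \<delta>).
        AE x\<in>ball x0 R in lebesgue.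
          (\<lambda>t. landau_op a \<gamma> t f (\<Gamma> x t) - f x) \<in> o[at_right 0](\<lambda>t. of_real (t powr h))"
      unfolding z prod.case by (intro allI impI ballI rate[OF k(1,2) h k(3)])
  next
    assume *: "(a \<ge> min 1 \<gamma> \<and> 0 < \<beta> \<and> \<beta> < min 1 \<gamma> / a) \<or> (a < min 1 \<gamma> \<and> 0 < \<beta> \<and> \<beta> \<le> 1)"
    fix z assume "z \<in> D2 \<gamma> \<beta>"
    then obtain \<delta> h where z: "z = (\<delta>, h)" and h: "0 \<le> h" "h < min \<beta> \<gamma>" and \<delta>: "h \<le> \<beta> * \<delta>"
      by (auto simp: D2_def)
    have "a * \<beta> \<le> min 1 \<gamma>"
    proof (cases "a < min 1 \<gamma>")
      case True
      have "a * \<beta> \<le> a" using assms(2,5,6) by (simp add: mult_left_le)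
      with True show ?thesis by simp
    next
      case False
      with * have "\<beta> < min 1 \<gamma> / a" by auto
      then show ?thesis using assms(2) by (simp add: field_simps)
    qed
    then have k: "1 / \<beta> * min 1 \<gamma> \<ge> a" "1 / \<beta> * \<beta> \<ge> 1" "1 / \<beta> * h \<le> \<delta>"
      using \<delta> assms(5) by (simp_all add: field_simps)
    show "case z of (\<delta>, h) \<Rightarrow> \<forall>s>s0. \<forall>f\<in>sobolev (s + \<delta>).
        AE x\<in>ball x0 R in lebesgue.
          (\<lambda>t. landau_op a \<gamma> t f (\<Gamma> x t) - f x) \<in> o[at_right 0](\<lambda>t. of_real (t powr h))"
      unfolding z prod.case by (intro allI impI ballI rate[OF k(1,2) h k(3)])
  qed
qed

end
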